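(* Let $m,n,N\in\mathbb N_0$, let $q\in\mathbb C$ with $0<|q|<1$, and let $\alpha,a,b,c,d\in\mathbb C\setminus\{0\}$ be such that $(-q\alpha t;q)_\infty\neq 0$ and $(qt/\alpha;q)_\infty\ne 0$ for every $t\in\{a,b,c,d\}$. Suppose $n,m\le N$ and $|qabcd|<|q|^{2N}$. Then the $q^{-1}$-Askey--Wilson polynomials $\mathsf p_n[z;a,b,c,d|q]$ satisfy $$\sum_{k=-\infty}^\infty (1+q^{2k}\alpha^2)\,\mathsf p_m[q^k\alpha;a,b,c,d|q]\,\mathsf p_n[q^k\alpha;a,b,c,d|q]\,\frac{(\frac{\alpha}{a},\frac{\alpha}{b},\frac{\alpha}{c},\frac{\alpha}{d};q)_k}{(-q\alpha a,-q\alpha b,-q\alpha c,-q\alpha d;q)_k}(qabcd)^k$$ $$=\frac{(q,-\alpha^2,-\frac{q}{\alpha^2},-qab,-qac,-qad,-qbc,-qbd,-qcd;q)_\infty}{(-q\alpha a,-q\alpha b,-q\alpha c,-q\alpha d,\frac{qa}{\alpha},\frac{qb}{\alpha},\frac{qc}{\alpha},\frac{qd}{\alpha},qabcd;q)_\infty}$$ $$\times\, q^{-6\binom n2}(-a^2b^2c^2d^2)^n\,\frac{(q,-\frac1{ab},-\frac1{ac},-\frac1{ad},-\frac1{bc},-\frac1{bd},-\frac1{cd};q)_n\,(\frac1{qabcd};q)_{2n}}{(\frac1{qabcd};q)_n(\frac1{abcd};q)_{2n}}\,\delta_{m,n}.$$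
   Context: Notation: $\mathbb N_0=\{0,1,2,\dots\}$. For $n\in\mathbb N_0$, $(y;q)_n=\prod_{j=0}^{n-1}(1-yq^j)$, $(y;q)_\infty=\prod_{j\ge0}(1-yq^j)$; for negative indices, $(y;q)_{-j}=1/(yq^{-j};q)_j$ (so $1/(y;q)_{-j}=(yq^{-j};q)_j$), $j\in\mathbb N$. Products: $(y_1,\dots,y_r;q)_k=\prod_i(y_i;q)_k$, also for $k=\infty$. $\delta_{m,n}$ is the Kronecker delta. The $q^{-1}$-Askey--Wilson polynomials are polynomials of degree $n$ in $x=\frac12(z-z^{-1})$, defined by $\mathsf p_n[z;a,b,c,d|q]=i^{-n}p_n[iz;ia,ib,ic,id|q^{-1}]$, where $p_n$ is the Askey--Wilson polynomial in standard normalization, written as a function of $w$ with argument $\frac12(w+w^{-1})$. Explicitly, $$\mathsf p_n[z;a,b,c,d|q]=q^{-3\binom n2}(-a^2bcd)^n\sum_{k=0}^n\frac{(q^{-n},\frac{q^{n-1}}{abcd},\frac za,-\frac1{az};q)_k}{(q;q)_k}\,q^k\,\Big(-\frac{q^k}{ab},-\frac{q^k}{ac},-\frac{q^k}{ad};q\Big)_{n-k}.$$ *)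

theory Defs
  imports "HOL-Analysis.Analysis"
begin

text \<open>
  The \<open>q\<close>-shifted factorial \<open>(y;q)\<^sub>k\<close> for integer \<open>k\<close>, with \<open>(y;q)\<^bsub>-j\<^esub> = 1 / (y q\<^sup>-\<^sup>j;q)\<^sub>j\<close>.
  Since \<open>1 / (1 / x) = x\<close> also for \<open>x = 0\<close>, the convention \<open>1 / (y;q)\<^bsub>-j\<^esub> = (y q\<^sup>-\<^sup>j;q)\<^sub>j\<close>
  holds even when the right-hand side vanishes (lemma \<open>inverse_qpoch_neg\<close>).
\<close>

definition qpoch :: "complex \<Rightarrow> complex \<Rightarrow> int \<Rightarrow> complex" where
  "qpoch y q k =
     (if k \<ge> 0 then \<Prod>j<nat k. (1 - y * q ^ j)
      else 1 / (\<Prod>j<nat (- k). (1 - (y * q powi k) * q ^ j)))"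

definition qpoch_inf :: "complex \<Rightarrow> complex \<Rightarrow> complex" where
  "qpoch_inf y q = prodinf (\<lambda>j. 1 - y * q ^ j)"

definition qpochs :: "complex list \<Rightarrow> complex \<Rightarrow> int \<Rightarrow> complex" where
  "qpochs ys q k = (\<Prod>y\<leftarrow>ys. qpoch y q k)"

definition qpochs_inf :: "complex list \<Rightarrow> complex \<Rightarrow> complex" where
  "qpochs_inf ys q = (\<Prod>y\<leftarrow>ys. qpoch_inf y q)"

text \<open>
  Askey--Wilson polynomials in the standard normalization
  \<open>(ab,ac,ad;q)\<^sub>n / a\<^sup>n \<cdot> \<^sub>4\<phi>\<^sub>3(q\<^sup>-\<^sup>n, q\<^sup>n\<^sup>-\<^sup>1abcd, aw, a/w; ab, ac, ad; q, q)\<close>, as a function of \<open>w\<close>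
  (the polynomial variable is \<open>(w + 1/w) / 2\<close>).  The quotients \<open>(ab;q)\<^sub>n / (ab;q)\<^sub>k\<close> are written as
  \<open>(ab q\<^sup>k;q)\<^bsub>n-k\<^esub>\<close>, so that no division by zero occurs for special parameters; the uncancelled form
  is lemma \<open>askey_wilson_4phi3\<close>.
\<close>

definition askey_wilson ::
  "nat \<Rightarrow> complex \<Rightarrow> complex \<Rightarrow> complex \<Rightarrow> complex \<Rightarrow> complex \<Rightarrow> complex \<Rightarrow> complex" where
  "askey_wilson n w a b c d q =
     (1 / a ^ n) *
     (\<Sum>k\<le>n. qpochs [q powi (- int n), q powi (int n - 1) * (a * b * c * d), a * w, a / w] q (int k)
               / qpoch q q (int k) * q ^ k
               * qpochs [a * b * q ^ k, a * c * q ^ k, a * d * q ^ k] q (int (n - k)))"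

definition qinv_askey_wilson ::
  "nat \<Rightarrow> complex \<Rightarrow> complex \<Rightarrow> complex \<Rightarrow> complex \<Rightarrow> complex \<Rightarrow> complex \<Rightarrow> complex" where
  "qinv_askey_wilson n z a b c d q =
     \<i> powi (- int n) * askey_wilson n (\<i> * z) (\<i> * a) (\<i> * b) (\<i> * c) (\<i> * d) (inverse q)"

lemma qpoch_nat: "qpoch y q (int k) = (\<Prod>j<k. (1 - y * q ^ j))"
  by (simp add: qpoch_def)

lemma inverse_qpoch_neg:
  "1 / qpoch y q (- int j) = qpoch (y * q powi (- int j)) q (int j)"
  by (cases "j = 0") (auto simp: qpoch_def)

lemma qpoch_split: "qpoch y q (int (k + l)) = qpoch y q (int k) * qpoch (y * q ^ k) q (int l)"
  unfolding qpoch_nat by (induction l) (simp_all add: power_add mult_ac)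

lemma askey_wilson_4phi3:
  assumes "qpoch (a * b) q (int n) \<noteq> 0" "qpoch (a * c) q (int n) \<noteq> 0" "qpoch (a * d) q (int n) \<noteq> 0"
  shows "askey_wilson n w a b c d q =
     qpochs [a * b, a * c, a * d] q (int n) / a ^ n *
     (\<Sum>k\<le>n. qpochs [q powi (- int n), q powi (int n - 1) * (a * b * c * d), a * w, a / w] q (int k)
               / qpochs [q, a * b, a * c, a * d] q (int k) * q ^ k)"
proof -
  have *: "qpoch y q (int n) / qpoch y q (int k) = qpoch (y * q ^ k) q (int (n - k))"
    if "k \<le> n" "qpoch y q (int n) \<noteq> 0" for y k
  proof -
    have "qpoch y q (int n) = qpoch y q (int k) * qpoch (y * q ^ k) q (int (n - k))"
      using qpoch_split[of y q k "n - k"] that(1) by simp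
    then show ?thesis using that(2) by (metis mult_eq_0_iff nonzero_mult_div_cancel_left)
  qed
  show ?thesis
    unfolding askey_wilson_def qpochs_def sum_distrib_left
  proof (rule sum.cong)
    fix k assume "k \<in> {..n}"
    then have k: "k \<le> n" by simp
    show "1 / a ^ n *
       ((\<Prod>y\<leftarrow>[q powi - int n, q powi (int n - 1) * (a * b * c * d), a * w, a / w]. qpoch y q (int k))
         / qpoch q q (int k) * q ^ k
         * (\<Prod>y\<leftarrow>[a * b * q ^ k, a * c * q ^ k, a * d * q ^ k]. qpoch y q (int (n - k)))) =
       (\<Prod>y\<leftarrow>[a * b, a * c, a * d]. qpoch y q (int n)) / a ^ n *
       ((\<Prod>y\<leftarrow>[q powi - int n, q powi (int n - 1) * (a * b * c * d), a * w, a / w]. qpoch y q (int k))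
         / (\<Prod>y\<leftarrow>[q, a * b, a * c, a * d]. qpoch y q (int k)) * q ^ k)"
      unfolding list.map prod_list.Cons prod_list.Nil *[OF k assms(1), symmetric]
        *[OF k assms(2), symmetric] *[OF k assms(3), symmetric]
      by (simp add: divide_inverse mult_ac)
  qed simp
qed

lemma qpoch_inverse_base:
  assumes "y \<noteq> 0" "q \<noteq> 0"
  shows "qpoch y (inverse q) (int k) =
           qpoch (1 / y) q (int k) * (- y) ^ k * q powi (- int (k choose 2))"
proof (induction k)
  case 0
  show ?case by (simp add: qpoch_def numeral_2_eq_2)
next
  case (Suc k)
  have ch: "int (Suc k choose 2) = int (k choose 2) + int k"
    by (simp add: numeral_2_eq_2)
  have f: "1 - y * inverse q ^ k = (1 - 1 / y * q ^ k) * (- y) * q powi (- int k)"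
    using assms by (simp add: power_int_minus field_simps)
  have pw: "q powi (- int (Suc k choose 2)) = q powi (- int (k choose 2)) * q powi (- int k)"
    unfolding ch using assms power_int_add[of q "- int (k choose 2)" "- int k"] by simp
  have "qpoch y (inverse q) (int (Suc k)) = qpoch y (inverse q) (int k) * (1 - y * inverse q ^ k)"
    unfolding qpoch_nat by simp
  also have "\<dots> = (qpoch (1 / y) q (int k) * (1 - 1 / y * q ^ k)) * (- y) ^ Suc k
                    * q powi (- int (Suc k choose 2))"
    unfolding Suc.IH f pw by (simp add: mult_ac)
  also have "qpoch (1 / y) q (int k) * (1 - 1 / y * q ^ k) = qpoch (1 / y) q (int (Suc k))"
    unfolding qpoch_nat by simp
  finally show ?case .
qed

lemma choose_two_add: "(k + l) choose 2 = (k choose 2) + (l choose 2) + k * l"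
proof (induction l)
  case 0
  show ?case by (simp add: numeral_2_eq_2)
next
  case (Suc l)
  have S: "Suc m choose 2 = (m choose 2) + m" for m
    by (simp add: numeral_2_eq_2)
  have "(k + Suc l) choose 2 = ((k + l) choose 2) + (k + l)"
    using S[of "k + l"] by simp
  then show ?case unfolding S using Suc.IH by simp
qed

lemma qinv_askey_wilson_explicit:
  assumes nz: "q \<noteq> 0" "a \<noteq> 0" "b \<noteq> 0" "c \<noteq> 0" "d \<noteq> 0" "z \<noteq> 0"
  shows "qinv_askey_wilson n z a b c d q =
     q powi (- 3 * int (n choose 2)) * (- (a\<^sup>2 * b * c * d)) ^ n *
     (\<Sum>k\<le>n. qpochs [q powi (- int n), q powi (int n - 1) / (a * b * c * d), z / a, - 1 / (a * z)] q (int k)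
               / qpoch q q (int k) * q ^ k
               * qpochs [- (q ^ k / (a * b)), - (q ^ k / (a * c)), - (q ^ k / (a * d))] q (int (n - k)))"
proof -
  have "\<i> powi (- int n) * (1 / (\<i> * a) ^ n *
      (qpochs [inverse q powi (- int n), inverse q powi (int n - 1) * ((\<i> * a) * (\<i> * b) * (\<i> * c) * (\<i> * d)),
               (\<i> * a) * (\<i> * z), (\<i> * a) / (\<i> * z)] (inverse q) (int k)
        / qpoch (inverse q) (inverse q) (int k) * inverse q ^ k
        * qpochs [(\<i> * a) * (\<i> * b) * inverse q ^ k, (\<i> * a) * (\<i> * c) * inverse q ^ k,
                  (\<i> * a) * (\<i> * d) * inverse q ^ k] (inverse q) (int (n - k))))
      = q powi (- 3 * int (n choose 2)) * (- (a\<^sup>2 * b * c * d)) ^ n *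
        (qpochs [q powi (- int n), q powi (int n - 1) / (a * b * c * d), z / a, - 1 / (a * z)] q (int k)
        / qpoch q q (int k) * q ^ k
        * qpochs [- (q ^ k / (a * b)), - (q ^ k / (a * c)), - (q ^ k / (a * d))] q (int (n - k)))"
    (is "?L = ?R") if kn: "k \<le> n" for k
  proof -
    obtain l where l: "n = k + l" using le_Suc_ex[OF kn] ..
    define T where "T = q powi (- int (k choose 2))"
    define U where "U = q powi (- int (l choose 2))"
    define V where "V = q ^ (k * l)"
    have T0: "T \<noteq> 0" and U0: "U \<noteq> 0" and V0: "V \<noteq> 0" using nz by (simp_all add: T_def U_def V_def)
    have ch: "int (n choose 2) = int (k choose 2) + int (l choose 2) + int (k * l)"
    proof -
      have "(k + l) choose 2 = (k choose 2) + (l choose 2) + k * l"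
        by (rule choose_two_add)
      then show ?thesis using l by simp
    qed
    have W: "q powi (- 3 * int (n choose 2)) = (T * U / V) ^ 3"
    proof -
      have "q powi (- int (n choose 2)) = T * U / V"
      proof -
        have e: "- int (n choose 2) = (- int (k choose 2) + - int (l choose 2)) + - int (k * l)"
          unfolding ch by simp
        show ?thesis unfolding e T_def U_def V_def using nz
          by (simp only: power_int_add power_int_minus power_int_of_nat divide_inverse simp_thms)
      qed
      then show ?thesis
        using power_int_mult[of q "- int (n choose 2)" 3] by (simp add: mult.commute)
    qed
    note inv = qpoch_inverse_base[OF _ nz(1)]
    define B where "B y m = qpoch y q (int m)" for y m
    have p1: "qpoch (inverse q powi (- int n)) (inverse q) (int k) = B (q powi (- int n)) k * (- (q ^ n)) ^ k * T"
      using inv[of "q ^ n" k] nz by (simp add: B_def T_def power_int_minus field_simps)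
    have e2: "inverse q powi (int n - 1) * ((\<i> * a) * (\<i> * b) * (\<i> * c) * (\<i> * d)) = q * (a * b * c * d) / q ^ n"
      using nz by (simp add: power_int_diff field_simps)
    have e2': "1 / (q * (a * b * c * d) / q ^ n) = q powi (int n - 1) / (a * b * c * d)"
      using nz by (simp add: power_int_diff field_simps)
    have p2: "qpoch (q * (a * b * c * d) / q ^ n) (inverse q) (int k)
        = B (q powi (int n - 1) / (a * b * c * d)) k * (- (q * (a * b * c * d) / q ^ n)) ^ k * T"
      using inv[of "q * (a * b * c * d) / q ^ n" k] nz unfolding e2' B_def T_def by simp
    have p3: "qpoch ((\<i> * a) * (\<i> * z)) (inverse q) (int k) = B (- 1 / (a * z)) k * (a * z) ^ k * T"
      using inv[of "(\<i> * a) * (\<i> * z)" k] nz by (simp add: B_def T_def mult_ac)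
    have p4: "qpoch ((\<i> * a) / (\<i> * z)) (inverse q) (int k) = B (z / a) k * (- (a / z)) ^ k * T"
      using inv[of "(\<i> * a) / (\<i> * z)" k] nz by (simp add: B_def T_def mult_ac)
    have p5: "qpoch (inverse q) (inverse q) (int k) = B q k * (- (1 / q)) ^ k * T"
      using inv[of "inverse q" k] nz by (simp add: B_def T_def divide_inverse)
    have p6: "qpoch ((\<i> * a) * (\<i> * x) * inverse q ^ k) (inverse q) (int l)
        = B (- (q ^ k / (a * x))) l * (a * x) ^ l / V * U" if "x \<noteq> 0" for x
    proof -
      have e: "(\<i> * a) * (\<i> * x) * inverse q ^ k = - (a * x / q ^ k)"
        using nz that by (simp add: field_simps)
      show ?thesis
        unfolding e using inv[of "- (a * x / q ^ k)" l] nz that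
        by (simp add: B_def U_def V_def power_divide power_mult)
    qed
    have i2: "\<i> powi (- int n) * (1 / (\<i> * a) ^ n * X) = (- 1 / a) ^ n * X" for X
    proof -
      have "\<i> powi (- int n) * (1 / (\<i> * a) ^ n) = (inverse \<i> * (1 / (\<i> * a))) ^ n"
        unfolding power_int_minus power_int_of_nat power_mult_distrib power_inverse power_one_over ..
      also have "inverse \<i> * (1 / (\<i> * a)) = - 1 / a" by (simp add: field_simps)
      finally show ?thesis by (simp only: mult.assoc[symmetric])
    qed
    have nk: "n - k = l" using l by simp
    have scal: "(- 1 / a) ^ n * ((- (q ^ n)) ^ k * (- (q * (a * b * c * d) / q ^ n)) ^ k * (a * z) ^ k * (- (a / z)) ^ k
           / (- (1 / q)) ^ k * (1 / q) ^ k * ((a * b) ^ l * (a * c) ^ l * (a * d) ^ l))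
         = (- (a\<^sup>2 * b * c * d)) ^ n * q ^ k"
    proof -
      have s1: "(- (q ^ n)) ^ k * (- (q * (a * b * c * d) / q ^ n)) ^ k * (a * z) ^ k * (- (a / z)) ^ k
           / (- (1 / q)) ^ k * (1 / q) ^ k = (a ^ 3 * b * c * d * q) ^ k"
        unfolding power_mult_distrib[symmetric] power_divide[symmetric]
        by (rule arg_cong[of _ _ "\<lambda>x. x ^ k"]) (use nz in \<open>simp add: field_simps power3_eq_cube\<close>)
      have s2: "(a * b) ^ l * (a * c) ^ l * (a * d) ^ l = (a ^ 3 * b * c * d) ^ l"
        unfolding power_mult_distrib[symmetric]
        by (rule arg_cong[of _ _ "\<lambda>x. x ^ l"]) (simp add: power3_eq_cube mult_ac)
      have s3: "- (a\<^sup>2 * b * c * d) = (- 1 / a) * (a ^ 3 * b * c * d)"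
        using nz by (simp add: field_simps power3_eq_cube power2_eq_square)
      show ?thesis unfolding s1 s2 unfolding s3 l by (simp only: power_mult_distrib power_add mult_ac)
    qed
    define S where "S = (- 1 / a) ^ n * ((- (q ^ n)) ^ k * (- (q * (a * b * c * d) / q ^ n)) ^ k * (a * z) ^ k * (- (a / z)) ^ k
           / (- (1 / q)) ^ k * (1 / q) ^ k * ((a * b) ^ l * (a * c) ^ l * (a * d) ^ l))"
    define P where "P = B (q powi (- int n)) k * B (q powi (int n - 1) / (a * b * c * d)) k * B (z / a) k * B (- 1 / (a * z)) k
           / B q k * (B (- (q ^ k / (a * b))) l * B (- (q ^ k / (a * c))) l * B (- (q ^ k / (a * d))) l)"
    have "?L = S * (T * U / V) ^ 3 * P"
      unfolding i2 qpochs_def list.map prod_list.Cons prod_list.Nil e2 nk p1 p2 p3 p4 p5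
        p6[OF nz(3)] p6[OF nz(4)] p6[OF nz(5)] S_def P_def
      using T0 by (simp add: divide_inverse power_mult_distrib power3_eq_cube mult_ac power_inverse)
    also have "\<dots> = ?R"
      unfolding S_def scal W qpochs_def list.map prod_list.Cons prod_list.Nil nk P_def B_def
      by (simp add: divide_inverse mult_ac)
    finally show ?thesis .
  qed
  then show ?thesis
    unfolding qinv_askey_wilson_def askey_wilson_def sum_distrib_left
    by (intro sum.cong) auto
qed

end

theory Submission
  imports Defs "HOL-Computational_Algebra.Polynomial"
begin

text \<open>
  Put \<open>z = q\<^sup>k\<alpha>\<close>.  Up to a factor independent of \<open>k\<close>, the weight of the bilateral series is
  \<open>W\<^sub>k(a,b,c,d) = (1 + z\<^sup>2) (\<alpha> powi (4 k)) (q powi (2 k\<^sup>2 - k)) \<Prod>\<^sub>t (-qzt, qt/z; q)\<^sub>\<infinity>\<close>,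
  the product running over \<open>t = a, b, c, d\<close> (\<open>weight\<close>, \<open>bilateral_summand_eq_weight\<close>).
  This form has no denominators in the parameters, so they may be shifted by powers of \<open>q\<close>, and even be
  set to zero, without case distinctions.

  Total mass.  The telescoping series of \<open>\<Prod>\<^sub>t (1 + zt) - \<Prod>\<^sub>t (z - t)\<close> against a multiple of the weight
  yields the contiguous relation
  \<open>(1 - qabcd) F(a,b,c,d) = (1 + qab)(1 + qac)(1 + qad) F(qa,b,c,d)\<close> for \<open>F = \<Sum>\<^sub>k W\<^sub>k\<close>
  (\<open>weight_sum_contiguous\<close>).  Iterating it drives \<open>a\<close> to \<open>0\<close>, and dominated convergence applies; doing this
  for all parameters leaves the constant \<open>F(0,0,0,0)\<close>, a theta series.  It is found from the parameters
  \<open>0, 0, \<alpha>, -1/\<alpha>\<close>, for which a single term survives.  The outcome is Bailey's sum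
  (\<open>bailey_6psi6\<close>).

  Moments.  With \<open>\<phi>\<^sub>i(z;a) = (z/a, -1/(az); q)\<^sub>i\<close> (\<open>aw_basis\<close>), multiplying the weight by \<open>\<phi>\<^sub>i(z;a) \<phi>\<^sub>j(z;b)\<close>
  amounts to replacing \<open>a, b\<close> by \<open>q\<^sup>-\<^sup>ia, q\<^sup>-\<^sup>jb\<close>.  All these moments are therefore values of Bailey's
  sum (\<open>aw_basis_moment\<close>).

  Orthogonality.  The explicit formula expands \<open>p\<^sub>n\<close> in the basis \<open>\<phi>\<^sub>k(z;a)\<close>.  Paired with \<open>\<phi>\<^sub>j(z;b)\<close> it
  turns into a balanced terminating \<open>\<^sub>3\<phi>\<^sub>2\<close>: an \<open>n\<close>-fold \<open>q\<close>-difference of a polynomial of degree below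
  \<open>n\<close> if \<open>j < n\<close>, which vanishes, and of a polynomial over one linear factor if \<open>j = n\<close>, which has a
  closed form (\<open>saalschuetz_sum_eq_0\<close>, \<open>saalschuetz_sum\<close>).  Since \<open>p\<^sub>m\<close> is a combination of the
  \<open>\<phi>\<^sub>j(z;b)\<close> with \<open>j \<le> m\<close> and known leading coefficient (\<open>qinv_askey_wilson_connection\<close>), this settles
  both the case \<open>m < n\<close> and the norm.  Only total shifts \<open>i + j \<le> 2 N\<close> occur, which is what the
  hypothesis on \<open>qabcd\<close> allows.
\<close>

section \<open>Shifted factorials\<close>

lemma qpoch_0 [simp]: "qpoch y q 0 = 1"
  by (simp add: qpoch_def)

lemma qpoch_Suc: "qpoch y q (int (Suc k)) = qpoch y q (int k) * (1 - y * q ^ k)"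
  unfolding qpoch_nat by simp

lemma qpoch_Suc_left: "qpoch y q (int (Suc k)) = (1 - y) * qpoch (y * q) q (int k)"
  using qpoch_split[of y q 1 k] by (simp add: qpoch_def)

lemma convergent_prod_qpoch:
  fixes q y :: complex
  assumes "norm q < 1"
  shows "convergent_prod (\<lambda>j. 1 - y * q ^ j)"
proof -
  have "summable (\<lambda>j. norm (1 - y * q ^ j - 1))"
    using assms by (auto simp: norm_mult norm_power intro!: summable_mult summable_geometric)
  then show ?thesis
    by (intro abs_convergent_prod_imp_convergent_prod)
       (simp only: abs_convergent_prod_conv_summable)
qed

lemma qpoch_tendsto_qpoch_inf:
  assumes "norm q < 1"
  shows "(\<lambda>n. qpoch y q (int n)) \<longlonglongrightarrow> qpoch_inf y q"
  using convergent_prod_LIMSEQ[OF convergent_prod_qpoch[OF assms, of y]]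
  unfolding qpoch_nat qpoch_inf_def by (simp only: LIMSEQ_lessThan_iff_atMost)

lemma qpoch_inf_split:
  assumes "norm q < 1"
  shows "qpoch_inf y q = qpoch y q (int n) * qpoch_inf (y * q ^ n) q"
proof (rule LIMSEQ_unique)
  show "(\<lambda>k. qpoch y q (int (k + n))) \<longlonglongrightarrow> qpoch_inf y q"
    by (rule LIMSEQ_ignore_initial_segment[OF qpoch_tendsto_qpoch_inf[OF assms]])
  show "(\<lambda>k. qpoch y q (int (k + n))) \<longlonglongrightarrow> qpoch y q (int n) * qpoch_inf (y * q ^ n) q"
    unfolding add.commute[of _ n] qpoch_split
    by (intro tendsto_intros qpoch_tendsto_qpoch_inf assms)
qed

lemma qpoch_inf_step:
  assumes "norm q < 1"
  shows "qpoch_inf y q = (1 - y) * qpoch_inf (y * q) q"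
  using qpoch_inf_split[OF assms, of y 1] by (simp add: qpoch_def)

lemma qpoch_inf_0 [simp]: "qpoch_inf 0 q = 1"
  by (simp add: qpoch_inf_def)

lemma qpoch_inf_nonzero:
  assumes "norm q < 1" "\<And>j. y * q ^ j \<noteq> 1"
  shows "qpoch_inf y q \<noteq> 0"
  unfolding qpoch_inf_def using assms(2)
  by (intro prodinf_nonzero convergent_prod_qpoch[OF assms(1)]) (metis eq_iff_diff_eq_0)

lemma qpoch_inf_nonzero_small:
  assumes "norm q < 1" "norm y < 1"
  shows "qpoch_inf y q \<noteq> 0"
proof (rule qpoch_inf_nonzero[OF assms(1)])
  fix j
  have "norm (y * q ^ j) \<le> norm y * 1"
    unfolding norm_mult norm_power by (intro mult_left_mono power_le_one) (use assms in auto)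
  then show "y * q ^ j \<noteq> 1" using assms(2) by auto
qed

lemma qpoch_inf_eq_0:
  assumes "norm q < 1" "y * q ^ n = 1"
  shows "qpoch_inf y q = 0"
proof -
  have "qpoch y q (int (Suc n)) = 0"
    unfolding qpoch_Suc using assms(2) by simp
  then show ?thesis
    using qpoch_inf_split[OF assms(1), of y "Suc n"] by simp
qed

text \<open>
  Taking \<open>y = -Y\<close> and a positive base makes every factor as large as its norm permits, so one value
  of the product bounds all those with \<open>\<bar>y\<bar> \<le> Y\<close>.
\<close>

lemma norm_qpoch_inf_le:
  assumes "norm q < 1" "norm y \<le> Y"
  shows "norm (qpoch_inf y q) \<le> norm (qpoch_inf (- of_real Y) (of_real (norm q)))"
proof (rule LIMSEQ_le)
  show "(\<lambda>n. norm (qpoch y q (int n))) \<longlonglongrightarrow> norm (qpoch_inf y q)"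
    by (intro tendsto_norm qpoch_tendsto_qpoch_inf assms)
  show "(\<lambda>n. norm (qpoch (- of_real Y) (of_real (norm q)) (int n)))
          \<longlonglongrightarrow> norm (qpoch_inf (- of_real Y) (of_real (norm q)))"
    by (intro tendsto_norm qpoch_tendsto_qpoch_inf) (use assms in auto)
  have Y: "Y \<ge> 0" using assms(2) norm_ge_zero order_trans by blast
  have "norm (1 - y * q ^ j) \<le> norm (1 - (- of_real Y) * (of_real (norm q)) ^ j :: complex)" for j
  proof -
    have "norm (1 - y * q ^ j) \<le> 1 + norm (y * q ^ j)"
      using norm_triangle_ineq4[of 1 "y * q ^ j"] by simp
    also have "\<dots> \<le> 1 + Y * norm q ^ j"
      using assms(2) by (simp add: norm_mult norm_power mult_right_mono)
    also have "\<dots> = norm (of_real (1 + Y * norm q ^ j) :: complex)"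
      using Y by (simp only: norm_of_real) simp
    finally show ?thesis by simp
  qed
  then show "\<exists>N. \<forall>n\<ge>N. norm (qpoch y q (int n))
                \<le> norm (qpoch (- of_real Y) (of_real (norm q)) (int n))"
    unfolding qpoch_nat prod_norm[symmetric] by (intro exI allI impI prod_mono) auto
qed

text \<open>
  The quotient of \<open>(x;q)\<^sub>\<infinity>\<close> by its \<open>n\<close>-th partial product tends to \<open>1\<close> when \<open>(x;q)\<^sub>\<infinity> \<noteq> 0\<close>; the latter is
  arranged by starting at \<open>x = y q\<^sup>N\<close> of norm below \<open>1\<close>.
\<close>

lemma qpoch_inf_tendsto_1:
  assumes "norm q < 1"
  shows "(\<lambda>n. qpoch_inf (y * q ^ n) q) \<longlonglongrightarrow> 1"
proof -
  obtain N where N: "\<And>n. n \<ge> N \<Longrightarrow> norm (y * q ^ n) < 1"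
  proof -
    have "(\<lambda>n. y * q ^ n) \<longlonglongrightarrow> y * 0"
      by (intro tendsto_intros LIMSEQ_power_zero assms)
    then have "eventually (\<lambda>n. norm (y * q ^ n) < 1) sequentially"
      using order_tendstoD(2)[OF tendsto_norm, of "\<lambda>n. y * q ^ n" "y * 0" sequentially 1] by simp
    then show ?thesis using that by (auto simp: eventually_sequentially)
  qed
  let ?x = "y * q ^ N"
  have nz: "qpoch_inf ?x q \<noteq> 0"
    by (rule qpoch_inf_nonzero_small[OF assms N]) simp
  have "(\<lambda>n. qpoch ?x q (int n)) \<longlonglongrightarrow> qpoch_inf ?x q"
    by (rule qpoch_tendsto_qpoch_inf[OF assms])
  from tendsto_divide[OF tendsto_const this nz]
  have "(\<lambda>n. qpoch_inf ?x q / qpoch ?x q (int n)) \<longlonglongrightarrow> 1"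
    using nz by (metis divide_self)
  moreover have "qpoch_inf ?x q / qpoch ?x q (int n) = qpoch_inf (y * q ^ (n + N)) q" for n
    using qpoch_inf_split[OF assms, of ?x n] nz by (auto simp: power_add mult_ac)
  ultimately have "(\<lambda>n. qpoch_inf (y * q ^ (n + N)) q) \<longlonglongrightarrow> 1" by simp
  then show ?thesis by (rule LIMSEQ_offset)
qed

lemma choose_2_Suc: "Suc n choose 2 = (n choose 2) + n"
  by (simp add: numeral_2_eq_2)

lemma two_mult_choose_two: "2 * (n choose 2) + n = n * n"
  by (induction n) (simp_all add: choose_2_Suc binomial_eq_0)

text \<open>
  Reading the product backwards, \<open>1 - x/q\<^sup>j = (-x/q\<^sup>j)(1 - q\<^sup>j/x)\<close> in each factor.
\<close>

lemma qpoch_reverse: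
  assumes "q \<noteq> 0" "x \<noteq> 0"
  shows "qpoch (q * (x / q ^ n)) q (int n) = qpoch (1 / x) q (int n) * ((- x) ^ n / q ^ (n choose 2))"
proof (induction n)
  case 0
  show ?case by (simp add: numeral_2_eq_2)
next
  case (Suc n)
  have "q * (x / q ^ Suc n) = x / q ^ n" using assms by simp
  then have "qpoch (q * (x / q ^ Suc n)) q (int (Suc n)) = (1 - x / q ^ n) * qpoch (q * (x / q ^ n)) q (int n)"
    unfolding qpoch_Suc_left by (simp add: mult_ac)
  also have "1 - x / q ^ n = (1 - 1 / x * q ^ n) * (- x / q ^ n)"
    using assms by (simp add: field_simps)
  finally show ?case
    unfolding Suc.IH qpoch_Suc choose_2_Suc power_add
    by (simp only: power_Suc mult_ac times_divide_eq_left times_divide_eq_right divide_divide_eq_left)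
qed

lemma qpoch_inf_reverse:
  assumes "norm q < 1" "q \<noteq> 0" "x \<noteq> 0"
  shows "qpoch_inf (q * (x / q ^ n)) q =
     qpoch (1 / x) q (int n) * ((- x) ^ n / q ^ (n choose 2)) * qpoch_inf (q * x) q"
  using qpoch_inf_split[OF assms(1), of "q * (x / q ^ n)" n] qpoch_reverse[OF assms(2,3), of n] assms(2)
  by simp

section \<open>Convergence of the bilateral series\<close>

text \<open>
  The factor of the weight that belongs to one parameter \<open>t\<close>; it is invariant under
  \<open>z \<mapsto> -1/z\<close>.
\<close>

definition pair_factor :: "complex \<Rightarrow> complex \<Rightarrow> complex \<Rightarrow> complex" where
  "pair_factor q z t = qpoch_inf (- q * z * t) q * qpoch_inf (q * t / z) q"

text \<open>
  The weight and the telescoping sequence are both combinations of these terms, with exponents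
  \<open>j = \<plusminus>1\<close> and \<open>\<bar>j\<bar> \<le> 2\<close> respectively, so that convergence is studied only once.
\<close>

definition bilateral_term ::
  "complex \<Rightarrow> complex \<Rightarrow> complex \<Rightarrow> complex \<Rightarrow> complex \<Rightarrow> complex \<Rightarrow> int \<Rightarrow> int \<Rightarrow> complex" where
  "bilateral_term q \<alpha> a b c d j k =
     \<alpha> powi (4 * k) * q powi (2 * k\<^sup>2 + j * k) *
     (pair_factor q (q powi k * \<alpha>) a * pair_factor q (q powi k * \<alpha>) b *
      pair_factor q (q powi k * \<alpha>) c * pair_factor q (q powi k * \<alpha>) d)"

text \<open>
  Bounds \<open>pair_factor\<close> when \<open>q\<close> and \<open>z\<close> have norms \<open>r\<close> and \<open>x\<close>: all signs are chosen to make the factors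
  large.
\<close>

definition pair_majorant :: "real \<Rightarrow> real \<Rightarrow> real \<Rightarrow> real" where
  "pair_majorant r x t =
     norm (qpoch_inf (- of_real (r * x * t)) (of_real r)) *
     norm (qpoch_inf (- of_real (r * t / x)) (of_real r))"

definition bilateral_majorant ::
  "real \<Rightarrow> real \<Rightarrow> real \<Rightarrow> real \<Rightarrow> real \<Rightarrow> real \<Rightarrow> int \<Rightarrow> int \<Rightarrow> real" where
  "bilateral_majorant r A a b c d j k =
     A powi (4 * k) * r powi (2 * k\<^sup>2 + j * k) *
     (pair_majorant r (r powi k * A) a * pair_majorant r (r powi k * A) b *
      pair_majorant r (r powi k * A) c * pair_majorant r (r powi k * A) d)"

lemma pair_factor_shift:
  assumes "norm q < 1" "q \<noteq> 0" "z \<noteq> 0"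
  shows "pair_factor q (q * z) t * (1 + q * z * t) = pair_factor q z t * (1 - t / z)"
proof -
  have 1: "qpoch_inf (- q * z * t) q = (1 + q * z * t) * qpoch_inf (- q * (q * z) * t) q"
    using qpoch_inf_step[OF assms(1), of "- q * z * t"] by (simp add: mult_ac)
  have 2: "qpoch_inf (q * t / (q * z)) q = (1 - t / z) * qpoch_inf (q * t / z) q"
    using qpoch_inf_step[OF assms(1), of "t / z"] assms by (simp add: mult_ac)
  show ?thesis
    unfolding pair_factor_def 1 2 by (simp add: mult_ac)
qed

lemma pair_majorant_nonneg: "pair_majorant r x t \<ge> 0"
  by (simp add: pair_majorant_def)

lemma pair_majorant_shift_le:
  assumes "0 < r" "r < 1" "0 < x" "0 \<le> t"
  shows "x * pair_majorant r (r * x) t \<le> (x + t) * pair_majorant r x t"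
proof -
  have r: "norm (of_real r :: complex) < 1" using assms by simp
  define U where "U = norm (qpoch_inf (- of_real (r * (r * x) * t)) (of_real r))"
  define V where "V = norm (qpoch_inf (- of_real (r * t / x)) (of_real r))"
  have nrm: "norm (1 + of_real y :: complex) = 1 + y" if "y \<ge> 0" for y :: real
    using that norm_of_real[of "1 + y", where 'a=complex] by simp
  have 1: "norm (qpoch_inf (- of_real (r * x * t)) (of_real r)) = (1 + r * x * t) * U"
    using qpoch_inf_step[OF r, of "- of_real (r * x * t)"] nrm[of "r * x * t"] assms
    by (simp add: U_def norm_mult mult_ac)
  have 2: "norm (qpoch_inf (- of_real (r * t / (r * x))) (of_real r)) = (1 + t / x) * V"
    using qpoch_inf_step[OF r, of "- of_real (t / x)"] nrm[of "t / x"] assms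
    by (simp add: V_def norm_mult mult_ac)
  have "x * pair_majorant r (r * x) t = x * (U * ((1 + t / x) * V))"
    unfolding pair_majorant_def 2 U_def ..
  also have "\<dots> = (x + t) * (1 * U * V)"
    using assms by (simp add: field_simps)
  also have "\<dots> \<le> (x + t) * ((1 + r * x * t) * U * V)"
    using assms by (intro mult_left_mono mult_right_mono) (auto simp: U_def V_def)
  also have "\<dots> = (x + t) * pair_majorant r x t"
    unfolding pair_majorant_def 1 V_def ..
  finally show ?thesis .
qed

lemma bilateral_majorant_nonneg:
  "0 < A \<Longrightarrow> 0 < r \<Longrightarrow> bilateral_majorant r A a b c d j k \<ge> 0"
  unfolding bilateral_majorant_def
  by (intro mult_nonneg_nonneg pair_majorant_nonneg zero_le_power_int) auto

text \<open>
  With \<open>x = r\<^sup>kA\<close>, the Gaussian factor contributes \<open>r\<^sup>2\<^sup>+\<^sup>jx\<^sup>4\<close> to the quotient of consecutive terms,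
  and each parameter contributes at most \<open>(x + t)/x\<close>.  For large \<open>k\<close> the bound tends to \<open>r\<^sup>2\<^sup>+\<^sup>jabcd\<close>, which
  decides the ratio test.
\<close>

lemma bilateral_majorant_step_le:
  assumes "0 < r" "r < 1" "0 < A" "0 \<le> a" "0 \<le> b" "0 \<le> c" "0 \<le> d"
  defines "x \<equiv> \<lambda>k. r powi k * A"
  shows "bilateral_majorant r A a b c d j (k + 1) \<le>
     r powi (2 + j) * ((x k + a) * (x k + b) * (x k + c) * (x k + d)) *
     bilateral_majorant r A a b c d j k"
proof -
  let ?x = "x k"
  have x: "?x > 0" using assms by (simp add: x_def)
  have x_eq: "?x = r powi k * A" by (simp add: x_def)
  have xs: "r powi (k + 1) * A = r * ?x"
    using assms by (simp add: x_def power_int_add)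
  define m where "m = (\<lambda>t. ?x * pair_majorant r (r * ?x) t)"
  define n where "n = (\<lambda>t. (?x + t) * pair_majorant r ?x t)"
  have mn: "m t \<le> n t" if "0 \<le> t" for t
    unfolding m_def n_def by (rule pair_majorant_shift_le[OF assms(1,2) x that])
  have m0: "0 \<le> m t" for t
    unfolding m_def using x by (intro mult_nonneg_nonneg pair_majorant_nonneg) auto
  have n0: "0 \<le> n t" if "0 \<le> t" for t
    using mn[OF that] m0[of t] by linarith
  have sq: "2 * (k + 1)\<^sup>2 + j * (k + 1) = (2 * k\<^sup>2 + j * k) + (2 + j) + 4 * k"
    by (simp add: power2_eq_square algebra_simps)
  have x4: "?x ^ 4 = r powi (4 * k) * A ^ 4"
    by (simp add: x_def power_mult_distrib power_int_mult mult.commute[of 4])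
  have "A powi (4 * (k + 1)) = A powi (4 * k) * A ^ 4"
    using assms by (simp add: power_int_add distrib_left)
  then have pre: "A powi (4 * (k + 1)) * r powi (2 * (k + 1)\<^sup>2 + j * (k + 1))
      = A powi (4 * k) * r powi (2 * k\<^sup>2 + j * k) * r powi (2 + j) * ?x ^ 4"
    unfolding sq x4 using assms by (simp add: power_int_add)
  have "m a * m b * m c * m d \<le> n a * n b * n c * n d"
    by (intro mult_mono mult_nonneg_nonneg mn m0 n0 assms)
  then have "A powi (4 * k) * r powi (2 * k\<^sup>2 + j * k) * r powi (2 + j) * (m a * m b * m c * m d)
     \<le> A powi (4 * k) * r powi (2 * k\<^sup>2 + j * k) * r powi (2 + j) * (n a * n b * n c * n d)"
    using assms by (intro mult_left_mono) auto
  then show ?thesis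
    unfolding bilateral_majorant_def pre xs m_def n_def x_eq[symmetric]
    by (simp add: power4_eq_xxxx mult_ac)
qed

lemma summable_bilateral_majorant_nat:
  assumes "0 < r" "r < 1" "0 < A" "0 \<le> a" "0 \<le> b" "0 \<le> c" "0 \<le> d"
    and "r powi (2 + j) * (a * b * c * d) < 1"
  shows "summable (\<lambda>n. bilateral_majorant r A a b c d j (int n))"
proof -
  define R where "R = (\<lambda>n. r powi (2 + j) *
    ((r ^ n * A + a) * (r ^ n * A + b) * (r ^ n * A + c) * (r ^ n * A + d)))"
  have "R \<longlonglongrightarrow> r powi (2 + j) * ((0 * A + a) * (0 * A + b) * (0 * A + c) * (0 * A + d))"
    unfolding R_def using assms by (intro tendsto_intros LIMSEQ_power_zero) auto
  moreover obtain e where e: "r powi (2 + j) * (a * b * c * d) < e" "e < 1"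
    using dense[OF assms(8)] by auto
  ultimately have "eventually (\<lambda>n. R n < e) sequentially"
    by (intro order_tendstoD) auto
  then obtain N where N: "\<And>n. n \<ge> N \<Longrightarrow> R n < e"
    by (auto simp: eventually_sequentially)
  show ?thesis
  proof (rule summable_ratio_test[OF e(2)])
    fix n assume "n \<ge> N"
    have "bilateral_majorant r A a b c d j (int (Suc n)) \<le> R n * bilateral_majorant r A a b c d j (int n)"
      using bilateral_majorant_step_le[OF assms(1-7), of j "int n"] by (simp add: R_def add.commute)
    also have "\<dots> \<le> e * bilateral_majorant r A a b c d j (int n)"
      using N[OF \<open>n \<ge> N\<close>] assms by (intro mult_right_mono bilateral_majorant_nonneg) auto
    finally show "norm (bilateral_majorant r A a b c d j (int (Suc n)))
        \<le> e * norm (bilateral_majorant r A a b c d j (int n))"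
      using bilateral_majorant_nonneg[OF assms(3,1), of a b c d j] by simp
  qed
qed

text \<open>
  The symmetry \<open>z \<mapsto> 1/z\<close> reduces the terms with negative index to those with positive index.
\<close>

lemma bilateral_majorant_reflect:
  assumes "0 < r" "0 < A"
  shows "bilateral_majorant r A a b c d j (- k) = bilateral_majorant r (1 / A) a b c d (- j) k"
proof -
  have *: "pair_majorant r (r powi (- k) * A) t = pair_majorant r (r powi k * (1 / A)) t" for t
    unfolding pair_majorant_def power_int_minus using assms
    by (simp add: divide_simps mult_ac)
  show ?thesis
    unfolding bilateral_majorant_def * using assms
    by (simp add: power_int_minus power_int_divide_distrib divide_simps)
qed

lemma summable_bilateral_majorant:
  assumes "0 < r" "r < 1" "0 < A" "0 \<le> a" "0 \<le> b" "0 \<le> c" "0 \<le> d"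
    and "r powi (2 + j) * (a * b * c * d) < 1" "r powi (2 - j) * (a * b * c * d) < 1"
  shows "bilateral_majorant r A a b c d j summable_on UNIV"
proof -
  let ?f = "bilateral_majorant r A a b c d j"
  have "(?f \<circ> int) summable_on UNIV"
    using summable_bilateral_majorant_nat[OF assms(1-8)] assms
    by (subst summable_on_UNIV_nonneg_real_iff) (auto intro: bilateral_majorant_nonneg simp: o_def)
  then have 1: "?f summable_on range int"
    by (subst summable_on_reindex) auto
  have "summable (\<lambda>n. bilateral_majorant r (1 / A) a b c d (- j) (int n))"
    using assms by (intro summable_bilateral_majorant_nat) auto
  then have "(?f \<circ> (\<lambda>n. - int n)) summable_on UNIV"
    using assms by (subst summable_on_UNIV_nonneg_real_iff)
      (auto intro: bilateral_majorant_nonneg simp: o_def bilateral_majorant_reflect)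
  then have 2: "?f summable_on range (\<lambda>n. - int n)"
    by (subst summable_on_reindex) (auto simp: inj_on_def)
  \<comment> \<open>The index \<open>0\<close> lies in both ranges, which is harmless for summability.\<close>
  have "k \<in> range int \<union> range (\<lambda>n. - int n)" for k
    by (cases k rule: int_cases2) auto
  then have "UNIV = range int \<union> range (\<lambda>n. - int n)" by blast
  with summable_on_union[OF 1 2] show ?thesis by simp
qed

lemma norm_pair_factor_le:
  assumes "norm q < 1" "norm t \<le> s"
  shows "norm (pair_factor q z t) \<le> pair_majorant (norm q) (norm z) s"
  unfolding pair_factor_def pair_majorant_def norm_mult
  using assms
  by (intro mult_mono norm_qpoch_inf_le) (auto simp: norm_mult norm_divide intro!: mult_left_mono divide_right_mono)

lemma norm_bilateral_term_le:
  assumes "norm q < 1" "q \<noteq> 0" "\<alpha> \<noteq> 0" "norm a \<le> a'" "norm b \<le> b'" "norm c \<le> c'" "norm d \<le> d'"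
  shows "norm (bilateral_term q \<alpha> a b c d j k)
     \<le> bilateral_majorant (norm q) (norm \<alpha>) a' b' c' d' j k"
proof -
  have *: "norm (pair_factor q (q powi k * \<alpha>) t) \<le> pair_majorant (norm q) (norm q powi k * norm \<alpha>) s"
    if "norm t \<le> s" for t s
    using norm_pair_factor_le[OF assms(1) that, of "q powi k * \<alpha>"]
    by (simp add: norm_mult norm_power_int)
  show ?thesis
    unfolding bilateral_term_def bilateral_majorant_def norm_mult norm_power_int
    by (intro mult_mono * assms mult_nonneg_nonneg pair_majorant_nonneg zero_le_power_int norm_ge_zero order_refl)
qed

lemma bilateral_term_summable:
  assumes "norm q < 1" "q \<noteq> 0" "\<alpha> \<noteq> 0"
    and "norm (q powi (2 + j) * (a * b * c * d)) < 1" "norm (q powi (2 - j) * (a * b * c * d)) < 1"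
  shows "bilateral_term q \<alpha> a b c d j summable_on UNIV"
proof (rule abs_summable_summable, rule Infinite_Sum.abs_summable_on_comparison_test')
  show "bilateral_majorant (norm q) (norm \<alpha>) (norm a) (norm b) (norm c) (norm d) j summable_on UNIV"
    using assms by (intro summable_bilateral_majorant) (auto simp: norm_mult norm_power_int)
qed (use assms norm_bilateral_term_le in auto)

section \<open>Bailey's sum of a very-well-poised \<open>\<^sub>6\<psi>\<^sub>6\<close>\<close>

text \<open>
  The very-well-poised weight with its denominators cleared: entire in \<open>a, b, c, d\<close> and symmetric in
  them.
\<close>

definition weight ::
  "complex \<Rightarrow> complex \<Rightarrow> complex \<Rightarrow> complex \<Rightarrow> complex \<Rightarrow> complex \<Rightarrow> int \<Rightarrow> complex" where
  "weight q \<alpha> a b c d k =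
     (1 + (q powi k * \<alpha>)\<^sup>2) * (\<alpha> powi (4 * k) * q powi (2 * k\<^sup>2 - k)) *
     (pair_factor q (q powi k * \<alpha>) a * pair_factor q (q powi k * \<alpha>) b *
      pair_factor q (q powi k * \<alpha>) c * pair_factor q (q powi k * \<alpha>) d)"

definition weight_sum ::
  "complex \<Rightarrow> complex \<Rightarrow> complex \<Rightarrow> complex \<Rightarrow> complex \<Rightarrow> complex \<Rightarrow> complex" where
  "weight_sum q \<alpha> a b c d = (\<Sum>\<^sub>\<infinity>k. weight q \<alpha> a b c d k)"

lemma weight_eq_bilateral_term:
  assumes "q \<noteq> 0"
  shows "weight q \<alpha> a b c d k =
    bilateral_term q \<alpha> a b c d (- 1) k + \<alpha>\<^sup>2 * bilateral_term q \<alpha> a b c d 1 k"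
proof -
  have "2 * k\<^sup>2 + 1 * k = (2 * k\<^sup>2 + - 1 * k) + k * 2" by simp
  moreover have "q powi ((2 * k\<^sup>2 + - 1 * k) + k * 2) = q powi (2 * k\<^sup>2 + - 1 * k) * (q powi k)\<^sup>2"
    using assms by (simp only: power_int_add power_int_mult simp_thms power_int_numeral)
  ultimately have "q powi (2 * k\<^sup>2 + 1 * k) = q powi (2 * k\<^sup>2 + - 1 * k) * (q powi k)\<^sup>2"
    by (simp only:)
  then show ?thesis
    unfolding weight_def bilateral_term_def by (simp add: algebra_simps)
qed

lemma norm_power_mult_less_1:
  fixes q x :: complex
  assumes "norm q < 1" "norm (q ^ i * x) < 1" "i \<le> j"
  shows "norm (q ^ j * x) < 1"
proof -
  have "norm (q ^ j * x) \<le> norm (q ^ i * x)"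
    unfolding norm_mult norm_power using assms by (intro mult_right_mono power_decreasing) auto
  with assms(2) show ?thesis by simp
qed

lemma bilateral_term_summable_nat:
  assumes "norm q < 1" "q \<noteq> 0" "\<alpha> \<noteq> 0" "norm (q ^ i * (a * b * c * d)) < 1"
    and "int i - 2 \<le> j" "j \<le> 2 - int i"
  shows "bilateral_term q \<alpha> a b c d j summable_on UNIV"
proof -
  have "norm (q powi l * (a * b * c * d)) < 1" if "int i \<le> l" for l
    using norm_power_mult_less_1[OF assms(1,4), of "nat l"] that by (simp add: power_int_def)
  then show ?thesis
    using assms by (intro bilateral_term_summable) auto
qed

lemma weight_summable:
  assumes "norm q < 1" "q \<noteq> 0" "\<alpha> \<noteq> 0" "norm (q * a * b * c * d) < 1"
  shows "weight q \<alpha> a b c d summable_on UNIV"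
proof -
  have "norm (q ^ 1 * (a * b * c * d)) < 1"
    using assms(4) by (simp add: mult_ac)
  note * = bilateral_term_summable_nat[OF assms(1-3) this]
  show ?thesis
    unfolding weight_eq_bilateral_term[OF assms(2)]
    by (intro summable_on_add summable_on_cmult_right *) auto
qed

lemma weight_has_sum:
  assumes "norm q < 1" "q \<noteq> 0" "\<alpha> \<noteq> 0" "norm (q * a * b * c * d) < 1"
  shows "(weight q \<alpha> a b c d has_sum weight_sum q \<alpha> a b c d) UNIV"
  unfolding weight_sum_def by (rule has_sum_infsum[OF weight_summable[OF assms]])

text \<open>
  Put \<open>s = qa\<close>.  The sequence \<open>H\<^sub>k\<close> below is summable, so the differences \<open>H\<^sub>k\<^sub>+\<^sub>1 - H\<^sub>k\<close> sum to zero.  With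
  \<open>e\<^sub>i\<close> the elementary symmetric functions of \<open>s, b, c, d\<close>,
  \<open>\<Prod>\<^sub>t (1 + zt) - \<Prod>\<^sub>t (z - t) = (1 + z\<^sup>2) ((1 - e\<^sub>4)(1 - z\<^sup>2) + (e\<^sub>1 + e\<^sub>3) z)\<close>,
  so \<open>H\<^sub>k\<^sub>+\<^sub>1 - H\<^sub>k\<close> is the weight for \<open>s\<close> times a polynomial of degree at most one in \<open>z - 1/z\<close>.  The weight
  for \<open>a\<close> is the weight for \<open>s\<close> times another such polynomial, and eliminating \<open>z - 1/z\<close> gives the relation.
\<close>

lemma weight_sum_contiguous:
  assumes q: "norm q < 1" "q \<noteq> 0" "\<alpha> \<noteq> 0" and conv: "norm (q * a * b * c * d) < 1"
  shows "(1 - q * a * b * c * d) * weight_sum q \<alpha> a b c d =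
     (1 + q * a * b) * (1 + q * a * c) * (1 + q * a * d) * weight_sum q \<alpha> (q * a) b c d"
proof -
  define s where "s = q * a"
  define e1 where "e1 = s + b + c + d"
  define e2 where "e2 = s * b + s * c + s * d + b * c + b * d + c * d"
  define e3 where "e3 = s * b * c + s * b * d + s * c * d + b * c * d"
  define e4 where "e4 = s * b * c * d"
  define z where "z = (\<lambda>k::int. q powi k * \<alpha>)"
  define \<phi> where "\<phi> = (\<lambda>k. pair_factor q (z k) s * pair_factor q (z k) b * pair_factor q (z k) c * pair_factor q (z k) d)"
  define P where "P = (\<lambda>k. \<alpha> powi (4 * k) * q powi (2 * k\<^sup>2 - 2 * k) * \<phi> k)"
  define H where "H = (\<lambda>k. P k * ((1 + z k * s) * (1 + z k * b) * (1 + z k * c) * (1 + z k * d)))"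
  have z0: "z k \<noteq> 0" for k using q by (simp add: z_def)
  have conv0: "norm (q ^ 0 * (s * b * c * d)) < 1"
    using conv by (simp add: s_def)
  note bsum = bilateral_term_summable_nat[OF q conv0]

  have H_expand: "H k = bilateral_term q \<alpha> s b c d (- 2) k + e1 * \<alpha> * bilateral_term q \<alpha> s b c d (- 1) k
      + e2 * \<alpha>\<^sup>2 * bilateral_term q \<alpha> s b c d 0 k + e3 * \<alpha> ^ 3 * bilateral_term q \<alpha> s b c d 1 k
      + e4 * \<alpha> ^ 4 * bilateral_term q \<alpha> s b c d 2 k" for k
  proof -
    have B: "\<alpha> ^ i * bilateral_term q \<alpha> s b c d (int i - 2) k = P k * z k ^ i" for i
    proof -
      have "2 * k\<^sup>2 + (int i - 2) * k = (2 * k\<^sup>2 - 2 * k) + k * int i" by (simp add: algebra_simps)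
      then have "q powi (2 * k\<^sup>2 + (int i - 2) * k) = q powi (2 * k\<^sup>2 - 2 * k) * (q powi k) ^ i"
        using q by (simp only: power_int_add power_int_mult power_int_of_nat simp_thms)
      then show ?thesis
        unfolding P_def \<phi>_def z_def bilateral_term_def by (simp add: power_mult_distrib mult_ac)
    qed
    have H: "H k = P k * z k ^ 0 + e1 * (P k * z k ^ 1) + e2 * (P k * z k ^ 2)
       + e3 * (P k * z k ^ 3) + e4 * (P k * z k ^ 4)"
      unfolding H_def e1_def e2_def e3_def e4_def by (simp add: algebra_simps power_numeral_reduce)
    show ?thesis
      unfolding H B[symmetric] by (simp add: mult_ac)
  qed
  have H_summable: "H summable_on UNIV"
    unfolding H_expand by (intro summable_on_add summable_on_cmult_right bsum) auto

  \<comment> \<open>Rewriting \<open>H\<^sub>k\<^sub>+\<^sub>1\<close> over the factor \<open>P\<^sub>k\<close> of \<open>H\<^sub>k\<close> turns \<open>\<Prod>\<^sub>t (1 + qzt)\<close> into \<open>\<Prod>\<^sub>t (z - t)\<close>.\<close>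
  have H_next: "H (k + 1) = P k * ((z k - s) * (z k - b) * (z k - c) * (z k - d))" for k
  proof -
    have zk: "z (k + 1) = q * z k" using q by (simp add: z_def power_int_add)
    have pre: "\<alpha> powi (4 * (k + 1)) * q powi (2 * (k + 1)\<^sup>2 - 2 * (k + 1)) =
       \<alpha> powi (4 * k) * q powi (2 * k\<^sup>2 - 2 * k) * z k ^ 4"
    proof -
      have e: "2 * (k + 1)\<^sup>2 - 2 * (k + 1) = (2 * k\<^sup>2 - 2 * k) + k * 4"
        by (simp add: power2_eq_square algebra_simps)
      have "q powi ((2 * k\<^sup>2 - 2 * k) + k * 4) = q powi (2 * k\<^sup>2 - 2 * k) * (q powi k) ^ 4"
        using q by (simp only: power_int_add power_int_mult simp_thms power_int_numeral)
      moreover have "\<alpha> powi (4 * (k + 1)) = \<alpha> powi (4 * k) * \<alpha> ^ 4"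
        using q by (simp add: power_int_add distrib_left)
      ultimately show ?thesis unfolding e z_def by (simp add: power_mult_distrib)
    qed
    have "H (k + 1) = \<alpha> powi (4 * (k + 1)) * q powi (2 * (k + 1)\<^sup>2 - 2 * (k + 1)) *
       ((pair_factor q (q * z k) s * (1 + q * z k * s)) * (pair_factor q (q * z k) b * (1 + q * z k * b)) *
        (pair_factor q (q * z k) c * (1 + q * z k * c)) * (pair_factor q (q * z k) d * (1 + q * z k * d)))"
      unfolding H_def P_def \<phi>_def zk by (simp add: mult_ac)
    also have "\<dots> = P k * ((z k * (1 - s / z k)) * (z k * (1 - b / z k)) * (z k * (1 - c / z k)) * (z k * (1 - d / z k)))"
      unfolding pair_factor_shift[OF q(1,2) z0] pre P_def \<phi>_def by (simp add: power4_eq_xxxx mult_ac)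
    finally show ?thesis using z0[of k] by (simp add: right_diff_distrib)
  qed

  obtain S where S: "(H has_sum S) UNIV" using H_summable by (auto simp: summable_on_def)
  have "bij_betw (\<lambda>k::int. k + 1) UNIV UNIV"
    by (rule bij_betwI[of _ _ _ "\<lambda>k. k - 1"]) auto
  with S have S': "((\<lambda>k. H (k + 1)) has_sum S) UNIV"
    by (subst has_sum_reindex_bij_betw)

  have main: "(1 - e4) * weight q \<alpha> a b c d k =
      (1 + s * b) * (1 + s * c) * (1 + s * d) * weight q \<alpha> s b c d k + (s / \<alpha>) * (H (k + 1) - H k)" for k
  proof -
    have pa: "pair_factor q (z k) a = (1 + z k * s) * (1 - s / z k) * pair_factor q (z k) s"
      using qpoch_inf_step[OF q(1), of "- z k * s"] qpoch_inf_step[OF q(1), of "s / z k"]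
      unfolding pair_factor_def s_def by (simp add: mult_ac)
    define g where "g = \<alpha> powi (4 * k) * q powi (2 * k\<^sup>2 - k)"
    have e: "2 * k\<^sup>2 - 2 * k = (2 * k\<^sup>2 - k) + - k" by simp
    have "q powi (2 * k\<^sup>2 - 2 * k) = q powi (2 * k\<^sup>2 - k) * q powi (- k)"
      unfolding e using q by (simp only: power_int_add simp_thms)
    then have P: "P k = g * (\<alpha> / z k) * \<phi> k"
      unfolding P_def g_def z_def using q by (simp add: power_int_minus divide_inverse)
    have z_eq: "q powi k * \<alpha> = z k" by (simp add: z_def)
    define u where "u = s / z k"
    have s: "s = u * z k" using z0[of k] by (simp add: u_def)
    define X where "X = (z k - s) * (z k - b) * (z k - c) * (z k - d)"
    define Y where "Y = (1 + z k * s) * (1 + z k * b) * (1 + z k * c) * (1 + z k * d)"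
    define K where "K = (1 + s * b) * (1 + s * c) * (1 + s * d)"
    have alg: "(1 - e4) * (1 + z k ^ 2) * ((1 + z k * s) * (1 - s / z k)) =
       K * (1 + z k ^ 2) + (s / z k) * (X - Y)"
      unfolding e4_def u_def[symmetric] X_def Y_def K_def unfolding s by algebra
    have "(1 - e4) * weight q \<alpha> a b c d k = ((1 - e4) * (1 + z k ^ 2) * ((1 + z k * s) * (1 - s / z k))) * g * \<phi> k"
      unfolding weight_def z_eq pa g_def \<phi>_def by (simp only: mult_ac)
    also have "\<dots> = K * ((1 + z k ^ 2) * g * \<phi> k) + (s / \<alpha>) * (g * (\<alpha> / z k) * \<phi> k * X - g * (\<alpha> / z k) * \<phi> k * Y)"
      unfolding alg using q by (simp add: algebra_simps diff_divide_distrib)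
    also have "g * (\<alpha> / z k) * \<phi> k * X - g * (\<alpha> / z k) * \<phi> k * Y = H (k + 1) - H k"
      unfolding H_next unfolding H_def P X_def Y_def ..
    also have "(1 + z k ^ 2) * g * \<phi> k = weight q \<alpha> s b c d k"
      unfolding weight_def g_def \<phi>_def z_def ..
    finally show ?thesis unfolding K_def .
  qed

  have conv': "norm (q * s * b * c * d) < 1"
    using norm_power_mult_less_1[OF q(1) conv0, of 1] by (simp add: mult_ac)
  have "((\<lambda>k. H (k + 1) + - H k) has_sum S + - S) UNIV"
    using S by (intro has_sum_add S') (simp add: has_sum_uminus)
  then have "((\<lambda>k. H (k + 1) - H k) has_sum 0) UNIV" by simp
  from has_sum_add[OF has_sum_cmult_right[OF weight_has_sum[OF q conv']] has_sum_cmult_right[OF this]]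
  have "((\<lambda>k. (1 - e4) * weight q \<alpha> a b c d k) has_sum
      (1 + s * b) * (1 + s * c) * (1 + s * d) * weight_sum q \<alpha> s b c d + (s / \<alpha>) * 0) UNIV"
    unfolding main .
  moreover have "((\<lambda>k. (1 - e4) * weight q \<alpha> a b c d k) has_sum
      (1 - e4) * weight_sum q \<alpha> a b c d) UNIV"
    by (intro has_sum_cmult_right weight_has_sum[OF q conv])
  ultimately show ?thesis
    using has_sum_unique by (fastforce simp: e4_def s_def)
qed

lemma norm_weight_le:
  assumes "norm q < 1" "q \<noteq> 0" "\<alpha> \<noteq> 0" "norm a \<le> A"
  shows "norm (weight q \<alpha> a b c d k) \<le>
    bilateral_majorant (norm q) (norm \<alpha>) A (norm b) (norm c) (norm d) (- 1) k +
    norm (\<alpha>\<^sup>2) * bilateral_majorant (norm q) (norm \<alpha>) A (norm b) (norm c) (norm d) 1 k"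
  unfolding weight_eq_bilateral_term[OF assms(2)]
  by (rule norm_triangle_le, unfold norm_mult, intro add_mono mult_left_mono norm_bilateral_term_le assms)
     auto

lemma weight_tendsto:
  assumes "norm q < 1"
  shows "(\<lambda>n. weight q \<alpha> (a * q ^ n) b c d k) \<longlonglongrightarrow> weight q \<alpha> 0 b c d k"
proof -
  have "(\<lambda>n. pair_factor q z (a * q ^ n)) \<longlonglongrightarrow> pair_factor q z 0" for z
  proof -
    have "(\<lambda>n. qpoch_inf ((- q * z * a) * q ^ n) q * qpoch_inf ((q * a / z) * q ^ n) q) \<longlonglongrightarrow> 1 * 1"
      by (intro tendsto_mult qpoch_inf_tendsto_1 assms)
    then show ?thesis
      by (simp add: pair_factor_def mult_ac)
  qed
  then show ?thesis
    unfolding weight_def by (intro tendsto_intros)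
qed

text \<open>
  Interchange of limit and summation: the majorant for \<open>a\<close> serves all \<open>a q\<^sup>n\<close>.
\<close>

lemma weight_sum_tendsto:
  assumes q: "norm q < 1" "q \<noteq> 0" "\<alpha> \<noteq> 0" and conv: "norm (q * a * b * c * d) < 1"
  shows "(\<lambda>n. weight_sum q \<alpha> (a * q ^ n) b c d) \<longlonglongrightarrow> weight_sum q \<alpha> 0 b c d"
proof -
  define M where "M = (\<lambda>j. bilateral_majorant (norm q) (norm \<alpha>) (norm a) (norm b) (norm c) (norm d) j)"
  have "norm q powi l * (norm a * norm b * norm c * norm d) < 1" if "l \<ge> 1" for l
    using norm_power_mult_less_1[of q 1 "a * b * c * d" "nat l"] conv q that
    by (simp add: power_int_def norm_mult norm_power mult_ac)
  then have "M j summable_on UNIV" if "\<bar>j\<bar> \<le> 1" for j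
    unfolding M_def using that q by (intro summable_bilateral_majorant) auto
  then have M: "(\<lambda>k. M (- 1) k + norm (\<alpha>\<^sup>2) * M 1 k) summable_on UNIV"
    by (intro summable_on_add summable_on_cmult_right) auto
  have "norm (a * q ^ n) \<le> norm a" for n
  proof -
    have "norm a * norm q ^ n \<le> norm a * 1"
      using q by (intro mult_left_mono power_le_one) auto
    then show ?thesis by (simp add: norm_mult norm_power)
  qed
  then have "uniform_limit UNIV (\<lambda>X n. \<Sum>k\<in>X. weight q \<alpha> (a * q ^ n) b c d k)
      (\<lambda>n. weight_sum q \<alpha> (a * q ^ n) b c d) (finite_subsets_at_top UNIV)"
    unfolding weight_sum_def using norm_weight_le[OF q]
    by (intro Weierstrass_m_test_general[OF _ M]) (auto simp: M_def)
  moreover have "((\<lambda>X. \<Sum>k\<in>X. weight q \<alpha> 0 b c d k) \<longlongrightarrow> weight_sum q \<alpha> 0 b c d)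
      (finite_subsets_at_top UNIV)"
    using weight_has_sum[OF q, of 0 b c d] by (simp add: has_sum_def)
  ultimately show ?thesis
    by (intro swap_uniform_limit'[where S = UNIV and F = "finite_subsets_at_top UNIV"
          and f = "\<lambda>X n. \<Sum>k\<in>X. weight q \<alpha> (a * q ^ n) b c d k"
          and g = "\<lambda>X. \<Sum>k\<in>X. weight q \<alpha> 0 b c d k"])
       (auto intro!: always_eventually tendsto_sum weight_tendsto q)
qed

lemma weight_sum_remove_first:
  assumes q: "norm q < 1" "q \<noteq> 0" "\<alpha> \<noteq> 0" and conv: "norm (q * a * b * c * d) < 1"
  shows "qpoch_inf (q * a * b * c * d) q * weight_sum q \<alpha> a b c d =
     qpoch_inf (- q * a * b) q * qpoch_inf (- q * a * c) q * qpoch_inf (- q * a * d) q *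
     weight_sum q \<alpha> 0 b c d"
proof (rule LIMSEQ_unique)
  have iter: "qpoch (q * a * b * c * d) q (int n) * weight_sum q \<alpha> a b c d =
     qpoch (- q * a * b) q (int n) * qpoch (- q * a * c) q (int n) * qpoch (- q * a * d) q (int n) *
     weight_sum q \<alpha> (a * q ^ n) b c d" for n
  proof (induction n)
    case (Suc n)
    have "norm (q ^ (n + 1) * (a * b * c * d)) < 1"
      by (rule norm_power_mult_less_1[of q 1]) (use q conv in \<open>auto simp: mult_ac\<close>)
    then have "norm (q * (a * q ^ n) * b * c * d) < 1" by (simp add: mult_ac)
    from weight_sum_contiguous[OF q this]
    have 1: "(1 - q * a * b * c * d * q ^ n) * weight_sum q \<alpha> (a * q ^ n) b c d =
      (1 - (- q * a * b) * q ^ n) * (1 - (- q * a * c) * q ^ n) * (1 - (- q * a * d) * q ^ n) *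
        weight_sum q \<alpha> (a * q ^ Suc n) b c d"
      by (simp add: mult_ac)
    have "qpoch (q * a * b * c * d) q (int (Suc n)) * weight_sum q \<alpha> a b c d =
       (1 - q * a * b * c * d * q ^ n) * (qpoch (q * a * b * c * d) q (int n) * weight_sum q \<alpha> a b c d)"
      unfolding qpoch_Suc by (simp only: mult_ac)
    also have "\<dots> = qpoch (- q * a * b) q (int n) * qpoch (- q * a * c) q (int n) * qpoch (- q * a * d) q (int n) *
       ((1 - q * a * b * c * d * q ^ n) * weight_sum q \<alpha> (a * q ^ n) b c d)"
      unfolding Suc.IH by (simp only: mult_ac)
    finally show ?case unfolding 1 qpoch_Suc by (simp only: mult_ac)
  qed simp
  show "(\<lambda>n. qpoch (q * a * b * c * d) q (int n) * weight_sum q \<alpha> a b c d)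
     \<longlonglongrightarrow> qpoch_inf (q * a * b * c * d) q * weight_sum q \<alpha> a b c d"
    by (intro tendsto_intros qpoch_tendsto_qpoch_inf q)
  show "(\<lambda>n. qpoch (q * a * b * c * d) q (int n) * weight_sum q \<alpha> a b c d)
     \<longlonglongrightarrow> qpoch_inf (- q * a * b) q * qpoch_inf (- q * a * c) q * qpoch_inf (- q * a * d) q *
     weight_sum q \<alpha> 0 b c d"
    unfolding iter by (intro tendsto_intros qpoch_tendsto_qpoch_inf weight_sum_tendsto q conv)
qed

lemma weight_sum_commute:
  "weight_sum q \<alpha> a b c d = weight_sum q \<alpha> b a c d"
  "weight_sum q \<alpha> a b c d = weight_sum q \<alpha> a c b d"
  "weight_sum q \<alpha> a b c d = weight_sum q \<alpha> a b d c"
  unfolding weight_sum_def weight_def by (simp_all only: mult_ac)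

lemma weight_sum_eq_weight_sum_0:
  assumes q: "norm q < 1" "q \<noteq> 0" "\<alpha> \<noteq> 0" and conv: "norm (q * a * b * c * d) < 1"
  shows "qpoch_inf (q * a * b * c * d) q * weight_sum q \<alpha> a b c d =
     qpoch_inf (- q * a * b) q * qpoch_inf (- q * a * c) q * qpoch_inf (- q * a * d) q *
     qpoch_inf (- q * b * c) q * qpoch_inf (- q * b * d) q * qpoch_inf (- q * c * d) q *
     weight_sum q \<alpha> 0 0 0 0"
proof -
  have 1: "weight_sum q \<alpha> 0 b c d = qpoch_inf (- q * b * c) q * qpoch_inf (- q * b * d) q * weight_sum q \<alpha> 0 0 c d"
    using weight_sum_remove_first[OF q, of b 0 c d] weight_sum_commute(1)[of q \<alpha> 0 b c d] by simp
  have swap: "weight_sum q \<alpha> 0 0 c d = weight_sum q \<alpha> c 0 0 d" for c d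
    by (rule trans[OF weight_sum_commute(2) weight_sum_commute(1)])
  have 2: "weight_sum q \<alpha> 0 0 c d = qpoch_inf (- q * c * d) q * weight_sum q \<alpha> 0 0 0 d"
    using weight_sum_remove_first[OF q, of c 0 0 d] unfolding swap[of c d] by simp
  have "weight_sum q \<alpha> 0 0 0 d = weight_sum q \<alpha> d 0 0 0"
    by (rule trans[OF weight_sum_commute(3) swap])
  then have 3: "weight_sum q \<alpha> 0 0 0 d = weight_sum q \<alpha> 0 0 0 0"
    using weight_sum_remove_first[OF q, of d 0 0 0] by simp
  show ?thesis
    unfolding weight_sum_remove_first[OF q conv] 1 2 3 by (simp only: mult_ac)
qed

text \<open>
  For the parameters \<open>0, 0, \<alpha>, -1/\<alpha>\<close> the factor of \<open>\<alpha>\<close> vanishes when \<open>k > 0\<close> and that of \<open>-1/\<alpha>\<close>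
  when \<open>k < 0\<close>, so the series is its term at \<open>k = 0\<close>.  Since \<open>weight_sum q \<alpha> 0 0 0 0\<close> is the theta
  series of the \<open>\<alpha>\<^sup>2\<^sup>m q\<^bsup>m(m-1)/2\<^esup>\<close> with even and odd \<open>m\<close> taken in pairs, this is Jacobi's triple product.
\<close>

lemma weight_sum_0:
  assumes q: "norm q < 1" "q \<noteq> 0" "\<alpha> \<noteq> 0"
  shows "weight_sum q \<alpha> 0 0 0 0 = qpoch_inf q q * qpoch_inf (- \<alpha>\<^sup>2) q * qpoch_inf (- q / \<alpha>\<^sup>2) q"
proof -
  \<comment> \<open>One of the infinite products contains the factor \<open>1 - q\<^sup>0\<close>.\<close>
  have w: "weight q \<alpha> 0 0 \<alpha> (- 1 / \<alpha>) k = 0" if "k \<noteq> 0" for k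
  proof (cases "k > 0")
    case True
    then obtain n where k: "k = int (Suc n)" by (metis zero_less_imp_eq_int gr0_conv_Suc)
    have "q powi k = q * q ^ n" unfolding k power_int_of_nat by simp
    then have "q * \<alpha> / (q powi k * \<alpha>) * q ^ n = 1"
      using q by simp
    from qpoch_inf_eq_0[OF q(1) this] have "pair_factor q (q powi k * \<alpha>) \<alpha> = 0"
      by (simp add: pair_factor_def)
    then show ?thesis by (simp add: weight_def)
  next
    case False
    with \<open>k \<noteq> 0\<close> have "- k > 0" by simp
    then obtain n where "- k = int (Suc n)" by (metis zero_less_imp_eq_int gr0_conv_Suc)
    then have k: "k = - int (Suc n)" by simp
    have "q powi k = 1 / (q * q ^ n)"
      unfolding k power_int_minus power_int_of_nat by (simp add: divide_inverse)
    then have "- q * (q powi k * \<alpha>) * (- 1 / \<alpha>) * q ^ n = 1"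
      using q by simp
    from qpoch_inf_eq_0[OF q(1) this] have "pair_factor q (q powi k * \<alpha>) (- 1 / \<alpha>) = 0"
      by (simp add: pair_factor_def)
    then show ?thesis by (simp add: weight_def)
  qed
  have qq: "qpoch_inf q q \<noteq> 0" by (rule qpoch_inf_nonzero_small[OF q(1,1)])
  have p1: "pair_factor q \<alpha> \<alpha> = qpoch_inf (- (\<alpha>\<^sup>2) * q) q * qpoch_inf q q"
    unfolding pair_factor_def using q by (simp add: power2_eq_square mult_ac)
  have p2: "pair_factor q \<alpha> (- 1 / \<alpha>) = qpoch_inf q q * qpoch_inf (- q / \<alpha>\<^sup>2) q"
    unfolding pair_factor_def using q by (simp add: power2_eq_square)
  have p0: "pair_factor q \<alpha> 0 = 1" by (simp add: pair_factor_def)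
  have step: "(1 + \<alpha>\<^sup>2) * qpoch_inf (- (\<alpha>\<^sup>2) * q) q = qpoch_inf (- (\<alpha>\<^sup>2)) q"
    using qpoch_inf_step[OF q(1), of "- (\<alpha>\<^sup>2)"] by simp
  have "weight_sum q \<alpha> 0 0 \<alpha> (- 1 / \<alpha>) = (\<Sum>\<^sub>\<infinity>k\<in>{0}. weight q \<alpha> 0 0 \<alpha> (- 1 / \<alpha>) k)"
    unfolding weight_sum_def by (intro infsum_cong_neutral) (use w in auto)
  also have "\<dots> = weight q \<alpha> 0 0 \<alpha> (- 1 / \<alpha>) 0"
    by simp
  also have "\<dots> = qpoch_inf q q * (qpoch_inf q q * ((1 + \<alpha>\<^sup>2) * qpoch_inf (- (\<alpha>\<^sup>2) * q) q) * qpoch_inf (- q / \<alpha>\<^sup>2) q)"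
    unfolding weight_def by (simp add: p0 p1[simplified] p2[simplified])
  finally have 1: "weight_sum q \<alpha> 0 0 \<alpha> (- 1 / \<alpha>) =
     qpoch_inf q q * (qpoch_inf q q * qpoch_inf (- (\<alpha>\<^sup>2)) q * qpoch_inf (- q / \<alpha>\<^sup>2) q)"
    unfolding step .
  have "- q * \<alpha> * (- 1 / \<alpha>) = q" using q by simp
  then have "weight_sum q \<alpha> 0 0 \<alpha> (- 1 / \<alpha>) = qpoch_inf q q * weight_sum q \<alpha> 0 0 0 0"
    using weight_sum_eq_weight_sum_0[OF q, of 0 0 \<alpha> "- 1 / \<alpha>"] by simp
  then show ?thesis
    unfolding 1 using qq by (simp only: mult_cancel_left) simp
qed

text \<open>
  In the usual notation this is the sum of the very-well-poised \<open>\<^sub>6\<psi>\<^sub>6\<close> with base parameter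
  \<open>-\<alpha>\<^sup>2\<close> and numerator parameters \<open>\<alpha>/a, \<alpha>/b, \<alpha>/c, \<alpha>/d\<close>, multiplied by the common denominators.
\<close>

theorem bailey_6psi6:
  assumes q: "norm q < 1" "q \<noteq> 0" "\<alpha> \<noteq> 0" and conv: "norm (q * a * b * c * d) < 1"
  shows "weight_sum q \<alpha> a b c d =
     qpochs_inf [q, - (\<alpha>\<^sup>2), - q / \<alpha>\<^sup>2, - q * a * b, - q * a * c, - q * a * d,
                 - q * b * c, - q * b * d, - q * c * d] q / qpoch_inf (q * a * b * c * d) q"
proof -
  have "qpoch_inf (q * a * b * c * d) q \<noteq> 0"
    by (rule qpoch_inf_nonzero_small[OF q(1) conv])
  then show ?thesis
    using weight_sum_eq_weight_sum_0[OF q conv] weight_sum_0[OF q]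
    by (simp add: qpochs_inf_def field_simps)
qed

section \<open>Moments of products of two Askey--Wilson bases\<close>

text \<open>
  A polynomial of degree \<open>n\<close> in \<open>z - 1/z\<close>, attached to the parameter \<open>t\<close>.
\<close>

definition aw_basis :: "complex \<Rightarrow> complex \<Rightarrow> nat \<Rightarrow> complex \<Rightarrow> complex" where
  "aw_basis q t n z = qpoch (z / t) q (int n) * qpoch (- 1 / (t * z)) q (int n)"

text \<open>
  Both infinite products gain \<open>n\<close> factors under \<open>t \<mapsto> t/q\<^sup>n\<close>; read backwards they are the two shifted
  factorials of \<open>aw_basis\<close>.
\<close>

lemma pair_factor_divide_power:
  assumes "norm q < 1" "q \<noteq> 0" "z \<noteq> 0" "t \<noteq> 0"
  shows "pair_factor q z (t / q ^ n) =
     (- (t\<^sup>2)) ^ n / (q ^ (n choose 2))\<^sup>2 * aw_basis q t n z * pair_factor q z t"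
proof -
  have e1: "- q * z * (t / q ^ n) = q * (- (z * t) / q ^ n)" by simp
  have e2: "q * (t / q ^ n) / z = q * ((t / z) / q ^ n)" by simp
  have e3: "qpoch (1 / - (z * t)) q (int n) = qpoch (- 1 / (t * z)) q (int n)"
    "qpoch (1 / (t / z)) q (int n) = qpoch (z / t) q (int n)" by (simp_all add: mult.commute)
  have e4: "q * - (z * t) = - q * z * t" "q * (t / z) = q * t / z" by simp_all
  have e5: "- (- (z * t)) * (- (t / z)) = - (t\<^sup>2)"
    using assms by (simp add: power2_eq_square)
  have "pair_factor q z (t / q ^ n) =
     (- (- (z * t))) ^ n * (- (t / z)) ^ n / (q ^ (n choose 2))\<^sup>2 * aw_basis q t n z * pair_factor q z t"
    unfolding pair_factor_def e1 e2 aw_basis_def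
    using qpoch_inf_reverse[OF assms(1,2), of "- (z * t)" n] qpoch_inf_reverse[OF assms(1,2), of "t / z" n] assms
    unfolding e3 e4 by (simp add: power2_eq_square mult_ac)
  then show ?thesis
    unfolding power_mult_distrib[symmetric] e5 .
qed

lemma weight_divide_power:
  assumes "norm q < 1" "q \<noteq> 0" "\<alpha> \<noteq> 0" "a \<noteq> 0" "b \<noteq> 0"
  shows "weight q \<alpha> (a / q ^ i) (b / q ^ j) c d k =
     ((- (a\<^sup>2)) ^ i / (q ^ (i choose 2))\<^sup>2 * ((- (b\<^sup>2)) ^ j / (q ^ (j choose 2))\<^sup>2)) *
     (aw_basis q a i (q powi k * \<alpha>) * aw_basis q b j (q powi k * \<alpha>) * weight q \<alpha> a b c d k)"
proof -
  have z: "q powi k * \<alpha> \<noteq> 0" using assms by simp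
  show ?thesis
    unfolding weight_def pair_factor_divide_power[OF assms(1,2) z assms(4)]
      pair_factor_divide_power[OF assms(1,2) z assms(5)]
    by (simp only: mult_ac)
qed

lemma weight_sum_divide_power:
  assumes q: "norm q < 1" "q \<noteq> 0" "\<alpha> \<noteq> 0" and nz: "a \<noteq> 0" "b \<noteq> 0" "c \<noteq> 0" "d \<noteq> 0"
    and conv: "norm (q * a * b * c * d / q ^ (i + j)) < 1"
  shows "weight_sum q \<alpha> (a / q ^ i) (b / q ^ j) c d =
     ((- (a\<^sup>2)) ^ i / (q ^ (i choose 2))\<^sup>2 * ((- (b\<^sup>2)) ^ j / (q ^ (j choose 2))\<^sup>2)) *
     (weight_sum q \<alpha> a b c d *
       (qpoch (- 1 / (a * b)) q (int (i + j)) *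
        (qpoch (- 1 / (a * c)) q (int i) * qpoch (- 1 / (a * d)) q (int i)) *
        (qpoch (- 1 / (b * c)) q (int j) * qpoch (- 1 / (b * d)) q (int j)) /
        qpoch (1 / (a * b * c * d)) q (int (i + j))))"
proof -
  have conv0: "norm (q * a * b * c * d) < 1"
    using norm_power_mult_less_1[OF q(1), of 0 "q * a * b * c * d / q ^ (i + j)" "i + j"] conv q by simp
  have conv1: "norm (q * (a / q ^ i) * (b / q ^ j) * c * d) < 1"
    using conv by (simp add: power_add)
  have r: "qpoch_inf (- q * X / q ^ n) q =
      qpoch (- 1 / X) q (int n) * (X ^ n / q ^ (n choose 2)) * qpoch_inf (- q * X) q" if "X \<noteq> 0" for X n
    using qpoch_inf_reverse[OF q(1,2), of "- X" n] that by simp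
  have r': "qpoch_inf (q * X / q ^ n) q =
      qpoch (1 / X) q (int n) * ((- X) ^ n / q ^ (n choose 2)) * qpoch_inf (q * X) q" if "X \<noteq> 0" for X n
    using qpoch_inf_reverse[OF q(1,2), of X n] that by simp
  have e: "- q * (a / q ^ i) * (b / q ^ j) = - q * (a * b) / q ^ (i + j)"
    "- q * (a / q ^ i) * c = - q * (a * c) / q ^ i" "- q * (a / q ^ i) * d = - q * (a * d) / q ^ i"
    "- q * (b / q ^ j) * c = - q * (b * c) / q ^ j" "- q * (b / q ^ j) * d = - q * (b * d) / q ^ j"
    "q * (a / q ^ i) * (b / q ^ j) * c * d = q * (a * b * c * d) / q ^ (i + j)"
    by (simp_all add: power_add)
  define Q where "Q = q ^ ((i + j) choose 2)"
  have Q: "Q \<noteq> 0" using q by (simp add: Q_def)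
  have scal: "((a * b) ^ (i + j) / Q) * ((a * c) ^ i / q ^ (i choose 2)) * ((a * d) ^ i / q ^ (i choose 2)) *
     ((b * c) ^ j / q ^ (j choose 2)) * ((b * d) ^ j / q ^ (j choose 2)) / ((- (a * b * c * d)) ^ (i + j) / Q) =
     (- (a\<^sup>2)) ^ i / (q ^ (i choose 2))\<^sup>2 * ((- (b\<^sup>2)) ^ j / (q ^ (j choose 2))\<^sup>2)"
  proof -
    have 1: "- (a\<^sup>2) = (a * b) * (a * c) * (a * d) / (- (a * b * c * d))"
      using nz by (simp add: field_simps power2_eq_square)
    have 2: "- (b\<^sup>2) = (a * b) * (b * c) * (b * d) / (- (a * b * c * d))"
      using nz by (simp add: field_simps power2_eq_square)
    show ?thesis
      unfolding 1 2 using Q by (simp only: power_divide power_mult_distrib power_add power2_eq_square) (simp add: mult_ac)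
  qed
  let ?K = "qpoch_inf q q * qpoch_inf (- (\<alpha>\<^sup>2)) q * qpoch_inf (- q / \<alpha>\<^sup>2) q"
  have "weight_sum q \<alpha> (a / q ^ i) (b / q ^ j) c d =
     (((a * b) ^ (i + j) / Q) * ((a * c) ^ i / q ^ (i choose 2)) * ((a * d) ^ i / q ^ (i choose 2)) *
     ((b * c) ^ j / q ^ (j choose 2)) * ((b * d) ^ j / q ^ (j choose 2)) / ((- (a * b * c * d)) ^ (i + j) / Q)) *
     ((?K * (qpoch_inf (- q * (a * b)) q * qpoch_inf (- q * (a * c)) q * qpoch_inf (- q * (a * d)) q *
        qpoch_inf (- q * (b * c)) q * qpoch_inf (- q * (b * d)) q * qpoch_inf (- q * c * d) q) /
          qpoch_inf (q * (a * b * c * d)) q) *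
       (qpoch (- 1 / (a * b)) q (int (i + j)) *
        (qpoch (- 1 / (a * c)) q (int i) * qpoch (- 1 / (a * d)) q (int i)) *
        (qpoch (- 1 / (b * c)) q (int j) * qpoch (- 1 / (b * d)) q (int j)) /
        qpoch (1 / (a * b * c * d)) q (int (i + j))))"
  proof -
    have alg: "\<And>k A1 S1 X1 A2 S2 X2 A3 S3 X3 A4 S4 X4 A5 S5 X5 X6 B T Z :: complex.
      k * ((A1 * S1 * X1) * (A2 * S2 * X2) * (A3 * S3 * X3) * (A4 * S4 * X4) * (A5 * S5 * X5) * X6) / (B * T * Z) =
      (S1 * S2 * S3 * S4 * S5 / T) * ((k * (X1 * X2 * X3 * X4 * X5 * X6) / Z) * (A1 * (A2 * A3) * (A4 * A5) / B))"
      by (simp add: mult_ac)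
    have "weight_sum q \<alpha> (a / q ^ i) (b / q ^ j) c d =
      ?K * (qpoch_inf (- q * (a * b) / q ^ (i + j)) q * qpoch_inf (- q * (a * c) / q ^ i) q *
        qpoch_inf (- q * (a * d) / q ^ i) q * qpoch_inf (- q * (b * c) / q ^ j) q *
        qpoch_inf (- q * (b * d) / q ^ j) q * qpoch_inf (- q * c * d) q) /
          qpoch_inf (q * (a * b * c * d) / q ^ (i + j)) q"
      unfolding bailey_6psi6[OF q conv1] qpochs_inf_def list.map prod_list.Cons prod_list.Nil e
      by (simp only: mult_1_right mult.assoc)
    moreover have "a * b \<noteq> 0" "a * c \<noteq> 0" "a * d \<noteq> 0" "b * c \<noteq> 0" "b * d \<noteq> 0" "a * b * c * d \<noteq> 0"
      using nz by simp_all
    note this(1-5)[THEN r] this(6)[THEN r']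
    ultimately show ?thesis by (simp only: alg Q_def)
  qed
  also have "?K * (qpoch_inf (- q * (a * b)) q * qpoch_inf (- q * (a * c)) q * qpoch_inf (- q * (a * d)) q *
        qpoch_inf (- q * (b * c)) q * qpoch_inf (- q * (b * d)) q * qpoch_inf (- q * c * d) q) /
          qpoch_inf (q * (a * b * c * d)) q = weight_sum q \<alpha> a b c d"
    unfolding bailey_6psi6[OF q conv0] qpochs_inf_def list.map prod_list.Cons prod_list.Nil
    by (simp only: mult_1_right mult_1_left mult_ac)
  finally show ?thesis unfolding scal .
qed

text \<open>
  The left-hand side is, up to a constant, the weight with parameters \<open>a/q\<^sup>i, b/q\<^sup>j, c, d\<close>, whose sum is
  known; the constants and powers of \<open>q\<close> produced by reversing the products on both sides cancel.
\<close>

lemma aw_basis_moment: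
  assumes q: "norm q < 1" "q \<noteq> 0" "\<alpha> \<noteq> 0" and nz: "a \<noteq> 0" "b \<noteq> 0" "c \<noteq> 0" "d \<noteq> 0"
    and conv: "norm (q * a * b * c * d / q ^ (i + j)) < 1"
  shows "((\<lambda>k. aw_basis q a i (q powi k * \<alpha>) * aw_basis q b j (q powi k * \<alpha>) * weight q \<alpha> a b c d k)
     has_sum
     (weight_sum q \<alpha> a b c d *
       (qpoch (- 1 / (a * b)) q (int (i + j)) *
        (qpoch (- 1 / (a * c)) q (int i) * qpoch (- 1 / (a * d)) q (int i)) *
        (qpoch (- 1 / (b * c)) q (int j) * qpoch (- 1 / (b * d)) q (int j)) /
        qpoch (1 / (a * b * c * d)) q (int (i + j))))) UNIV"
proof -
  define C where "C = (- (a\<^sup>2)) ^ i / (q ^ (i choose 2))\<^sup>2 * ((- (b\<^sup>2)) ^ j / (q ^ (j choose 2))\<^sup>2)"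
  have C: "C \<noteq> 0" using q nz by (simp add: C_def)
  have "norm (q * (a / q ^ i) * (b / q ^ j) * c * d) < 1"
    using conv by (simp add: power_add)
  from weight_has_sum[OF q this] show ?thesis
    unfolding weight_sum_divide_power[OF q nz conv] weight_divide_power[OF q nz(1,2)] C_def[symmetric]
    using C by (simp add: has_sum_cmult_right_iff)
qed

section \<open>Iterated \<open>q\<close>-differences\<close>

text \<open>
  The coefficient of \<open>x\<^sup>k\<close> in \<open>(1 - x)(1 - x/q)\<dots>(1 - x/q\<^sup>n\<^sup>-\<^sup>1)\<close>.
\<close>

definition q_difference_coeff :: "complex \<Rightarrow> nat \<Rightarrow> nat \<Rightarrow> complex" where
  "q_difference_coeff q n k = qpoch (q powi (- int n)) q (int k) / qpoch q q (int k) * q ^ k"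

text \<open>
  The operator \<open>(1 - \<eta>)(1 - \<eta>/q)\<dots>(1 - \<eta>/q\<^sup>n\<^sup>-\<^sup>1)\<close> with \<open>\<eta> f x = f (q x)\<close>.  It is kept as a function of
  \<open>x\<close> because its recursion in \<open>n\<close> moves the argument.
\<close>

definition q_difference :: "complex \<Rightarrow> nat \<Rightarrow> (complex \<Rightarrow> complex) \<Rightarrow> complex \<Rightarrow> complex" where
  "q_difference q n f x = (\<Sum>k\<le>n. q_difference_coeff q n k * f (x * q ^ k))"

lemma qpoch_q_q_nonzero:
  assumes "norm q < 1"
  shows "qpoch q q (int k) \<noteq> 0"
proof -
  have "norm (q ^ Suc j) < 1" for j
    using mult_left_mono[OF power_le_one[of "norm q" j], of "norm q"] assms
    by (simp add: norm_mult norm_power)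
  then have "q * q ^ j \<noteq> 1" for j
    by (metis norm_one order_less_irrefl power_Suc)
  then show ?thesis unfolding qpoch_nat by simp
qed

lemma q_difference_coeff_0_right [simp]: "q_difference_coeff q n 0 = 1"
  by (simp add: q_difference_coeff_def)

lemma q_difference_coeff_Suc_self:
  assumes "q \<noteq> 0"
  shows "q_difference_coeff q n (Suc n) = 0"
proof -
  have "qpoch (q powi (- int n)) q (int (Suc n)) = 0"
    unfolding qpoch_Suc using assms by (simp add: power_int_minus)
  then show ?thesis by (simp add: q_difference_coeff_def)
qed

lemma q_difference_coeff_Suc_Suc:
  assumes q: "norm q < 1" "q \<noteq> 0"
  shows "q_difference_coeff q (Suc n) (Suc k) =
    q_difference_coeff q n (Suc k) - q_difference_coeff q n k / q ^ n"
proof -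
  define A where "A = qpoch (1 / q ^ n) q (int k)"
  define B where "B = qpoch q q (int k)"
  have B: "B \<noteq> 0" "1 - q * q ^ k \<noteq> 0"
    using qpoch_q_q_nonzero[OF q(1), of "Suc k"] unfolding qpoch_Suc B_def by auto
  have p: "q powi (- int n) = 1 / q ^ n" for n
    by (simp add: power_int_minus divide_inverse)
  have 1: "qpoch (1 / q ^ Suc n) q (int (Suc k)) = (1 - 1 / q ^ Suc n) * A"
    unfolding qpoch_Suc_left A_def using q by simp
  have 2: "qpoch (1 / q ^ n) q (int (Suc k)) = A * (1 - q ^ k / q ^ n)"
    unfolding qpoch_Suc A_def by simp
  have 3: "qpoch q q (int (Suc k)) = B * (1 - q * q ^ k)"
    unfolding qpoch_Suc B_def ..
  have "(1 - 1 / q ^ Suc n) * A / (B * (1 - q * q ^ k)) * q ^ Suc k =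
     A * (1 - q ^ k / q ^ n) / (B * (1 - q * q ^ k)) * q ^ Suc k -
       A / B * q ^ k / q ^ n"
    using B q by (simp add: divide_simps) (simp add: algebra_simps)
  then show ?thesis
    unfolding q_difference_coeff_def p 1 2 3 unfolding A_def B_def .
qed

lemma q_difference_coeff_self:
  assumes "norm q < 1" "q \<noteq> 0"
  shows "q_difference_coeff q n n = (- 1) ^ n / q ^ (n choose 2)"
proof (induction n)
  case (Suc n)
  show ?case
    by (simp add: q_difference_coeff_Suc_Suc q_difference_coeff_Suc_self assms Suc choose_2_Suc power_add)
qed (simp add: numeral_2_eq_2)

lemma q_difference_0 [simp]: "q_difference q 0 f x = f x"
  by (simp add: q_difference_def)

lemma q_difference_Suc:
  assumes q: "norm q < 1" "q \<noteq> 0"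
  shows "q_difference q (Suc n) f x = q_difference q n f x - q_difference q n f (q * x) / q ^ n"
proof -
  define c where "c = q_difference_coeff q"
  have rec: "c (Suc n) (Suc k) = c n (Suc k) - c n k / q ^ n" for k
    unfolding c_def by (rule q_difference_coeff_Suc_Suc[OF q])
  have "q_difference q (Suc n) f x = (\<Sum>k\<le>Suc n. c (Suc n) k * f (x * q ^ k))"
    unfolding q_difference_def c_def ..
  also have "\<dots> = f x + (\<Sum>k\<le>n. c (Suc n) (Suc k) * f (x * q ^ Suc k))"
    by (subst sum.atMost_Suc_shift) (simp add: c_def)
  also have "\<dots> = (f x + (\<Sum>k\<le>n. c n (Suc k) * f (x * q ^ Suc k))) - (\<Sum>k\<le>n. c n k * f (x * q ^ Suc k)) / q ^ n"
    unfolding rec by (simp add: sum_subtractf sum_divide_distrib left_diff_distrib)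
  also have "f x + (\<Sum>k\<le>n. c n (Suc k) * f (x * q ^ Suc k)) = (\<Sum>k\<le>Suc n. c n k * f (x * q ^ k))"
    by (subst sum.atMost_Suc_shift) (simp add: c_def)
  also have "\<dots> = q_difference q n f x"
    unfolding q_difference_def by (simp add: c_def q_difference_coeff_Suc_self[OF q(2)])
  also have "(\<Sum>k\<le>n. c n k * f (x * q ^ Suc k)) = q_difference q n f (q * x)"
    unfolding q_difference_def c_def by (simp add: mult_ac)
  finally show ?thesis .
qed

text \<open>
  Powers are eigenfunctions of \<open>\<eta>\<close>; the product vanishes as soon as \<open>s < n\<close>.
\<close>

lemma q_difference_power:
  assumes "norm q < 1" "q \<noteq> 0"
  shows "q_difference q n (\<lambda>x. x ^ s) x = x ^ s * (\<Prod>i<n. 1 - q ^ s / q ^ i)"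
proof (induction n arbitrary: x)
  case (Suc n)
  show ?case
    unfolding q_difference_Suc[OF assms] Suc by (simp add: power_mult_distrib algebra_simps)
qed simp

lemma q_difference_sum:
  "q_difference q n (\<lambda>x. \<Sum>i\<in>I. f i x) x = (\<Sum>i\<in>I. q_difference q n (f i) x)"
  unfolding q_difference_def sum_distrib_left by (rule sum.swap)

lemma q_difference_cmult: "q_difference q n (\<lambda>x. c * f x) x = c * q_difference q n f x"
  unfolding q_difference_def sum_distrib_left by (simp add: mult_ac)

lemma q_difference_diff:
  "q_difference q n (\<lambda>x. f x - g x) x = q_difference q n f x - q_difference q n g x"
  unfolding q_difference_def by (simp add: right_diff_distrib sum_subtractf)

lemma q_difference_poly_eq_0:
  assumes q: "norm q < 1" "q \<noteq> 0" and "degree p < n"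
  shows "q_difference q n (poly p) x = 0"
proof -
  have "q_difference q n (poly p) x = (\<Sum>i\<le>degree p. coeff p i * q_difference q n (\<lambda>x. x ^ i) x)"
    unfolding poly_altdef q_difference_sum q_difference_cmult ..
  also have "\<dots> = 0"
  proof (rule sum.neutral, rule ballI)
    fix i assume "i \<in> {..degree p}"
    then have "i < n" using assms(3) by simp
    then have "(\<Prod>l<n. 1 - q ^ i / q ^ l) = 0" using q by (auto intro!: bexI[of _ i])
    then show "coeff p i * q_difference q n (\<lambda>x. x ^ i) x = 0"
      unfolding q_difference_power[OF q] by simp
  qed
  finally show ?thesis .
qed

lemma q_difference_geometric:
  assumes q: "norm q < 1" "q \<noteq> 0" and "\<And>k. k \<le> n \<Longrightarrow> Y * x * q ^ k \<noteq> 1"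
  shows "q_difference q n (\<lambda>x. 1 / (1 - Y * x)) x =
     (Y * x) ^ n * qpoch q q (int n) / qpoch (Y * x) q (int (Suc n))"
  using assms(3)
proof (induction n arbitrary: x)
  case 0
  show ?case by (simp add: qpoch_def)
next
  case (Suc n)
  have nz: "1 - Y * x * q ^ Suc n \<noteq> 0" "1 - Y * x \<noteq> 0"
    using Suc.prems[of "Suc n"] Suc.prems[of 0] by simp_all
  have IH2: "q_difference q n (\<lambda>x. 1 / (1 - Y * x)) (q * x) =
     (Y * (q * x)) ^ n * qpoch q q (int n) / qpoch (Y * (q * x)) q (int (Suc n))"
  proof (rule Suc.IH)
    show "Y * (q * x) * q ^ k \<noteq> 1" if "k \<le> n" for k
      using Suc.prems[of "Suc k"] that by (simp add: mult_ac)
  qed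
  have IH1: "q_difference q n (\<lambda>x. 1 / (1 - Y * x)) x =
     (Y * x) ^ n * qpoch q q (int n) / qpoch (Y * x) q (int (Suc n))"
    by (rule Suc.IH) (use Suc.prems in auto)
  define A where "A = qpoch (Y * x) q (int (Suc (Suc n)))"
  have A0: "A \<noteq> 0"
  proof -
    have "1 - Y * x * q ^ k \<noteq> 0" if "k < Suc (Suc n)" for k
      using Suc.prems[of k] that by simp
    then show ?thesis
      unfolding A_def qpoch_nat prod_zero_iff[OF finite_lessThan] by blast
  qed
  have A1: "qpoch (Y * x) q (int (Suc n)) = A / (1 - Y * x * q ^ Suc n)"
    unfolding A_def qpoch_Suc[of _ _ "Suc n"] using nz by simp
  have A2: "qpoch (Y * (q * x)) q (int (Suc n)) = A / (1 - Y * x)"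
    unfolding A_def qpoch_Suc_left[of _ _ "Suc n"] using nz by (simp add: mult_ac)
  show ?case
    unfolding q_difference_Suc[OF q] IH1 IH2 A1 A2 A_def[symmetric] qpoch_Suc[of q q n]
    using A0 q nz by (simp add: power_mult_distrib divide_simps) (simp add: algebra_simps)
qed

text \<open>
  Division with remainder by \<open>x - 1/Y\<close> splits the quotient into a geometric term and a polynomial of
  degree below \<open>n\<close>, which the operator annihilates.
\<close>

lemma q_difference_poly_geometric:
  assumes q: "norm q < 1" "q \<noteq> 0" and Y: "Y \<noteq> 0" "\<And>k. k \<le> n \<Longrightarrow> Y * q ^ k \<noteq> 1"
    and "degree p \<le> n"
  shows "q_difference q n (\<lambda>x. poly p x / (1 - Y * x)) 1 =
     poly p (1 / Y) * (Y ^ n * qpoch q q (int n) / qpoch Y q (int (Suc n)))"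
proof -
  define r where "r = synthetic_div p (1 / Y)"
  have p: "poly p x = poly p (1 / Y) + (x - 1 / Y) * poly r x" for x
    using arg_cong[OF synthetic_div_correct'[of "1 / Y" p], of "\<lambda>p. poly p x"]
    by (simp add: r_def algebra_simps)
  have "q_difference q n (\<lambda>x. poly p x / (1 - Y * x)) 1 =
     q_difference q n (\<lambda>x. poly p (1 / Y) * (1 / (1 - Y * x)) - 1 / Y * poly r x) 1"
    unfolding q_difference_def
  proof (rule sum.cong)
    fix k assume "k \<in> {..n}"
    then have "1 - Y * q ^ k \<noteq> 0" using Y(2)[of k] by auto
    then have "poly p (q ^ k) / (1 - Y * q ^ k) = poly p (1 / Y) * (1 / (1 - Y * q ^ k)) - 1 / Y * poly r (q ^ k)"
      unfolding p[of "q ^ k"] using Y(1) by (simp add: divide_simps) (simp add: algebra_simps)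
    then show "q_difference_coeff q n k * (poly p (1 * q ^ k) / (1 - Y * (1 * q ^ k))) =
       q_difference_coeff q n k *
         (poly p (1 / Y) * (1 / (1 - Y * (1 * q ^ k))) - 1 / Y * poly r (1 * q ^ k))"
      by simp
  qed simp
  also have "\<dots> = poly p (1 / Y) * q_difference q n (\<lambda>x. 1 / (1 - Y * x)) 1 - 1 / Y * q_difference q n (poly r) 1"
    unfolding q_difference_diff q_difference_cmult ..
  also have "q_difference q n (poly r) 1 = 0"
  proof (cases "degree p = 0")
    case True
    then have "r = 0" by (simp add: r_def synthetic_div_eq_0_iff)
    then show ?thesis by (simp add: q_difference_def)
  next
    case False
    then show ?thesis
      using assms(5) by (intro q_difference_poly_eq_0[OF q]) (auto simp: r_def degree_synthetic_div)
  qed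
  also have "q_difference q n (\<lambda>x. 1 / (1 - Y * x)) 1 = Y ^ n * qpoch q q (int n) / qpoch Y q (int (Suc n))"
    using q_difference_geometric[OF q, of n Y 1] Y(2) by simp
  finally show ?thesis by simp
qed

definition qpoch_poly :: "complex \<Rightarrow> complex \<Rightarrow> nat \<Rightarrow> complex poly" where
  "qpoch_poly u q n = (\<Prod>i<n. [:1, - (u * q ^ i):])"

lemma poly_qpoch_poly: "poly (qpoch_poly u q n) x = qpoch (u * x) q (int n)"
  unfolding qpoch_poly_def qpoch_nat poly_prod by (simp add: mult_ac)

lemma degree_qpoch_poly_le: "degree (qpoch_poly u q n) \<le> n"
proof -
  have "degree (qpoch_poly u q n) \<le> sum (degree \<circ> (\<lambda>i. [:1, - (u * q ^ i):])) {..<n}"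
    unfolding qpoch_poly_def by (rule degree_prod_sum_le) simp
  also have "\<dots> \<le> (\<Sum>i<n. 1)" by (intro sum_mono) simp
  finally show ?thesis by simp
qed

text \<open>
  The quotient \<open>(vq\<^sup>n\<^sup>-\<^sup>1;q)\<^sub>k / (v;q)\<^sub>k\<^sub>+\<^sub>j\<close> is a polynomial of degree \<open>n - 1 - j\<close> in \<open>q\<^sup>k\<close>, and
  \<open>(uq\<^sup>k;q)\<^sub>j\<close> has degree \<open>j\<close>, so the sum is an \<open>n\<close>-fold \<open>q\<close>-difference of a polynomial of degree at most
  \<open>n - 1\<close>.
\<close>

lemma saalschuetz_sum_eq_0:
  assumes q: "norm q < 1" "q \<noteq> 0" and v: "\<And>i. i < 2 * n \<Longrightarrow> v * q ^ i \<noteq> 1" and "j < n"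
  shows "(\<Sum>k\<le>n. q_difference_coeff q n k * (qpoch (u * q ^ k) q (int j) *
      qpoch (v * q ^ n / q) q (int k) / qpoch v q (int (k + j)))) = 0"
proof -
  obtain l where l: "n = Suc (j + l)" using \<open>j < n\<close> by (metis less_iff_Suc_add)
  have nz: "qpoch v q (int i) \<noteq> 0" if "i \<le> 2 * n" for i
    unfolding qpoch_nat prod_zero_iff[OF finite_lessThan] using v that by auto
  define p where "p = qpoch_poly u q j * qpoch_poly (v * q ^ j) q l"
  have "degree p \<le> j + l"
    unfolding p_def by (rule order_trans[OF degree_mult_le add_mono]) (rule degree_qpoch_poly_le)+
  then have 0: "q_difference q n (poly p) 1 = 0"
    by (intro q_difference_poly_eq_0[OF q]) (simp add: l)
  have "(\<Sum>k\<le>n. q_difference_coeff q n k * (qpoch (u * q ^ k) q (int j) *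
      qpoch (v * q ^ n / q) q (int k) / qpoch v q (int (k + j)))) =
      (\<Sum>k\<le>n. q_difference_coeff q n k * poly p (1 * q ^ k) / qpoch v q (int (j + l)))"
  proof (rule sum.cong)
    fix k assume "k \<in> {..n}"
    then have k: "k + j \<le> 2 * n" "j + l \<le> 2 * n" using l by auto
    have Y: "v * q ^ n / q = v * q ^ (j + l)" using q l by simp
    have "qpoch v q (int (k + j)) * qpoch (v * q ^ (k + j)) q (int l) = qpoch v q (int (j + l)) * qpoch (v * q ^ (j + l)) q (int k)"
      unfolding qpoch_split[symmetric] by (simp add: add_ac)
    then have "qpoch (v * q ^ n / q) q (int k) / qpoch v q (int (k + j)) =
       qpoch (v * q ^ (k + j)) q (int l) / qpoch v q (int (j + l))"
      unfolding Y frac_eq_eq[OF nz[OF k(1)] nz[OF k(2)]] by (simp only: mult_ac)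
    then show "q_difference_coeff q n k * (qpoch (u * q ^ k) q (int j) *
      qpoch (v * q ^ n / q) q (int k) / qpoch v q (int (k + j))) =
      q_difference_coeff q n k * poly p (1 * q ^ k) / qpoch v q (int (j + l))"
      unfolding p_def poly_mult poly_qpoch_poly
      by (simp add: power_add mult_ac flip: times_divide_eq_right)
  qed simp
  also have "\<dots> = q_difference q n (poly p) 1 / qpoch v q (int (j + l))"
    unfolding q_difference_def sum_divide_distrib ..
  finally show ?thesis unfolding 0 by simp
qed

text \<open>
  For \<open>j = n\<close> the quotient of the preceding lemma keeps one linear factor \<open>1 - Yq\<^sup>k\<close>, \<open>Y = vq\<^sup>n\<^sup>-\<^sup>1\<close>, in the
  denominator.  The condition on \<open>v\<close> starts with \<open>v/q \<noteq> 1\<close> because \<open>Y = v/q\<close> when \<open>n = 0\<close>.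
\<close>

lemma saalschuetz_sum:
  assumes q: "norm q < 1" "q \<noteq> 0" and v: "v \<noteq> 0" "\<And>i. i \<le> 2 * n \<Longrightarrow> v / q * q ^ i \<noteq> 1"
  shows "(\<Sum>k\<le>n. q_difference_coeff q n k * (qpoch (u * q ^ k) q (int n) *
      qpoch (v * q ^ n / q) q (int k) / qpoch v q (int (k + n)))) =
    qpoch (u / (v * q ^ n / q)) q (int n) * (v * q ^ n / q) ^ n * qpoch q q (int n) / qpoch v q (int (2 * n))"
proof -
  define Y where "Y = v * q ^ n / q"
  have Y0: "Y \<noteq> 0" using q v by (simp add: Y_def)
  have Yq: "Y * q ^ k \<noteq> 1" if "k \<le> n" for k
    using v(2)[of "n + k"] that by (simp add: Y_def power_add mult_ac)
  have Y1: "Y * q = v * q ^ n" using q by (simp add: Y_def)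
  have v': "v * q ^ i \<noteq> 1" if "i < 2 * n" for i
    using v(2)[of "Suc i"] that q by simp
  have nz: "qpoch v q (int i) \<noteq> 0" if "i \<le> 2 * n" for i
    unfolding qpoch_nat prod_zero_iff[OF finite_lessThan] using v' that by auto
  define p where "p = qpoch_poly u q n"
  have "(\<Sum>k\<le>n. q_difference_coeff q n k * (qpoch (u * q ^ k) q (int n) *
      qpoch Y q (int k) / qpoch v q (int (k + n)))) =
      (\<Sum>k\<le>n. q_difference_coeff q n k * (poly p (1 * q ^ k) / (1 - Y * (1 * q ^ k)))
        * ((1 - Y) / qpoch v q (int n)))"
  proof (rule sum.cong)
    fix k assume "k \<in> {..n}"
    then have k: "k \<le> n" by simp
    define P where "P = qpoch (v * q ^ n) q (int k)"
    define V where "V = qpoch v q (int n)"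
    have E: "1 - Y * q ^ k \<noteq> 0" using Yq[OF k] by simp
    have "qpoch Y q (int k) * (1 - Y * q ^ k) = (1 - Y) * P"
      unfolding P_def Y1[symmetric] qpoch_Suc[symmetric] qpoch_Suc_left[symmetric] ..
    then have 1: "qpoch Y q (int k) = (1 - Y) * P / (1 - Y * q ^ k)"
      using E by (simp add: nonzero_eq_divide_eq)
    have 2: "qpoch v q (int (k + n)) = V * P"
      unfolding V_def P_def add.commute[of k] by (rule qpoch_split)
    have "V * P \<noteq> 0"
      using nz[of "k + n"] k unfolding 2 by simp
    then have "qpoch Y q (int k) / qpoch v q (int (k + n)) = 1 / (1 - Y * q ^ k) * ((1 - Y) / V)"
      unfolding 1 2 by simp
    then show "q_difference_coeff q n k * (qpoch (u * q ^ k) q (int n) *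
      qpoch Y q (int k) / qpoch v q (int (k + n))) =
      q_difference_coeff q n k * (poly p (1 * q ^ k) / (1 - Y * (1 * q ^ k))) * ((1 - Y) / qpoch v q (int n))"
      unfolding p_def poly_qpoch_poly V_def mult_1 times_divide_eq_right[symmetric] by (simp only: mult.assoc) simp
  qed simp
  also have "\<dots> = q_difference q n (\<lambda>x. poly p x / (1 - Y * x)) 1 * ((1 - Y) / qpoch v q (int n))"
    unfolding q_difference_def sum_distrib_right ..
  also have "\<dots> = poly p (1 / Y) * (Y ^ n * qpoch q q (int n) / qpoch Y q (int (Suc n))) *
      ((1 - Y) / qpoch v q (int n))"
    by (subst q_difference_poly_geometric[OF q Y0 Yq]) (auto simp: p_def degree_qpoch_poly_le)
  also have "\<dots> = qpoch (u / Y) q (int n) * Y ^ n * qpoch q q (int n) / qpoch v q (int (2 * n))"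
  proof -
    have 1: "qpoch v q (int (2 * n)) = qpoch v q (int n) * qpoch (v * q ^ n) q (int n)"
      unfolding mult_2 by (rule qpoch_split)
    have 2: "qpoch Y q (int (Suc n)) = (1 - Y) * qpoch (v * q ^ n) q (int n)"
      unfolding qpoch_Suc_left Y1 ..
    have "1 - Y \<noteq> 0" using Yq[of 0] by simp
    then show ?thesis
      unfolding 1 2 p_def poly_qpoch_poly by (simp add: mult_ac)
  qed
  finally show ?thesis unfolding Y_def .
qed

section \<open>Orthogonality against the cleared weight\<close>

lemma aw_basis_Suc:
  assumes "z \<noteq> 0" "t \<noteq> 0"
  shows "aw_basis q t (Suc n) z =
    aw_basis q t n z * (1 - (q ^ n / t)\<^sup>2 - (q ^ n / t) * (z - 1 / z))"
proof -
  have x: "z / t * q ^ n = x * z" "- 1 / (t * z) * q ^ n = - (x / z)" if "x = q ^ n / t" for x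
    using that by simp_all
  have y: "(1 - x * z) * (1 - - (x / z)) = 1 - x\<^sup>2 - x * (z - 1 / z)" for x
    using assms(1) by (simp add: algebra_simps power2_eq_square)
  show ?thesis
    unfolding aw_basis_def qpoch_Suc x[OF refl] y[symmetric] by (simp only: mult_ac)
qed

text \<open>
  Multiplication by \<open>z - 1/z\<close> sends \<open>\<phi>\<^sub>j(z;t)\<close> to a combination of itself and \<open>\<phi>\<^sub>j\<^sub>+\<^sub>1(z;t)\<close>, so the expansion of
  \<open>\<phi>\<^sub>i\<^sub>+\<^sub>1(z;a)\<close> follows from that of \<open>\<phi>\<^sub>i(z;a)\<close>.  Only the leading coefficient
  enters the norm.
\<close>

lemma aw_basis_connection:
  assumes "q \<noteq> 0" "a \<noteq> 0" "b \<noteq> 0"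
  shows "\<exists>g. g i = (b / a) ^ i \<and>
    (\<forall>z. z \<noteq> 0 \<longrightarrow> aw_basis q a i z = (\<Sum>j\<le>i. g j * aw_basis q b j z))"
proof (induction i)
  case 0
  show ?case by (intro exI[of _ "\<lambda>_. 1"]) (simp add: aw_basis_def)
next
  case (Suc i)
  then obtain g where g: "g i = (b / a) ^ i"
    "\<And>z. z \<noteq> 0 \<Longrightarrow> aw_basis q a i z = (\<Sum>j\<le>i. g j * aw_basis q b j z)" by auto
  \<comment> \<open>\<open>(q\<^sup>i/a)(z - 1/z) = D\<^sub>j (q\<^sup>j/b)(z - 1/z)\<close>, and the right-hand side raises \<open>\<phi>\<^sub>j(z;b)\<close> to \<open>\<phi>\<^sub>j\<^sub>+\<^sub>1(z;b)\<close>.\<close>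
  define D where "D = (\<lambda>j. (q ^ i / a) / (q ^ j / b))"
  define A where "A = (\<lambda>j. g j * (1 - (q ^ i / a)\<^sup>2 - D j * (1 - (q ^ j / b)\<^sup>2)))"
  define h where "h = (\<lambda>j. (if j \<le> i then A j else 0) + (case j of 0 \<Rightarrow> 0 | Suc l \<Rightarrow> g l * D l))"
  show ?case
  proof (intro exI[of _ h] conjI allI impI)
    show "h (Suc i) = (b / a) ^ Suc i"
      using assms g(1) by (simp add: h_def D_def)
  next
    fix z :: complex assume z: "z \<noteq> 0"
    let ?X = "z - 1 / z"
    have step: "aw_basis q b j z * (1 - (q ^ i / a)\<^sup>2 - (q ^ i / a) * ?X) =
        (1 - (q ^ i / a)\<^sup>2 - D j * (1 - (q ^ j / b)\<^sup>2)) * aw_basis q b j z + D j * aw_basis q b (Suc j) z" for j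
    proof -
      have DE: "D j * (q ^ j / b) = q ^ i / a" using assms by (simp add: D_def)
      have alg: "B * (A - d * E * X) = (A - d * (1 - E\<^sup>2)) * B + d * (B * (1 - E\<^sup>2 - E * X))"
        for A B d E X :: complex
        by (simp add: algebra_simps)
      show ?thesis
        unfolding aw_basis_Suc[OF z assms(3)] DE[symmetric] by (rule alg)
    qed
    have "aw_basis q a (Suc i) z = (\<Sum>j\<le>i. g j * (aw_basis q b j z * (1 - (q ^ i / a)\<^sup>2 - (q ^ i / a) * ?X)))"
      unfolding aw_basis_Suc[OF z assms(2)] g(2)[OF z] sum_distrib_right by (simp only: mult.assoc)
    also have "\<dots> = (\<Sum>j\<le>i. A j * aw_basis q b j z) + (\<Sum>j\<le>i. g j * D j * aw_basis q b (Suc j) z)"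
      unfolding step sum.distrib[symmetric] A_def by (simp only: distrib_left mult.assoc)
    also have "(\<Sum>j\<le>i. A j * aw_basis q b j z) = (\<Sum>j\<le>Suc i. (if j \<le> i then A j else 0) * aw_basis q b j z)"
      by simp
    also have "(\<Sum>j\<le>i. g j * D j * aw_basis q b (Suc j) z) =
       (\<Sum>j\<le>Suc i. (case j of 0 \<Rightarrow> 0 | Suc l \<Rightarrow> g l * D l) * aw_basis q b j z)"
      by (subst sum.atMost_Suc_shift) simp
    finally show "aw_basis q a (Suc i) z = (\<Sum>j\<le>Suc i. h j * aw_basis q b j z)"
      unfolding h_def by (simp only: sum.distrib[symmetric] distrib_right)
  qed
qed

lemma has_sum_finite_sum:
  fixes f :: "'i \<Rightarrow> 'x \<Rightarrow> 'b :: topological_comm_monoid_add"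
  assumes "finite I" "\<And>i. i \<in> I \<Longrightarrow> (f i has_sum s i) A"
  shows "((\<lambda>x. \<Sum>i\<in>I. f i x) has_sum (\<Sum>i\<in>I. s i)) A"
  using assms by (induction I rule: finite_induct) (auto intro: has_sum_add)

definition qinv_aw_scale :: "complex \<Rightarrow> complex \<Rightarrow> complex \<Rightarrow> complex \<Rightarrow> complex \<Rightarrow> nat \<Rightarrow> complex" where
  "qinv_aw_scale q a b c d n = q powi (- 3 * int (n choose 2)) * (- (a\<^sup>2 * b * c * d)) ^ n"

definition qinv_aw_coeff :: "complex \<Rightarrow> complex \<Rightarrow> complex \<Rightarrow> complex \<Rightarrow> complex \<Rightarrow> nat \<Rightarrow> nat \<Rightarrow> complex" where
  "qinv_aw_coeff q a b c d n k =
     q_difference_coeff q n k * qpoch (1 / (a * b * c * d) * q ^ n / q) q (int k) *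
     (qpoch (- 1 / (a * b) * q ^ k) q (int (n - k)) * qpoch (- 1 / (a * c) * q ^ k) q (int (n - k)) *
      qpoch (- 1 / (a * d) * q ^ k) q (int (n - k)))"

lemma qinv_askey_wilson_expand:
  assumes "q \<noteq> 0" "a \<noteq> 0" "b \<noteq> 0" "c \<noteq> 0" "d \<noteq> 0" "z \<noteq> 0"
  shows "qinv_askey_wilson n z a b c d q =
    qinv_aw_scale q a b c d n * (\<Sum>k\<le>n. qinv_aw_coeff q a b c d n k * aw_basis q a k z)"
proof -
  have Y: "q powi (int n - 1) / (a * b * c * d) = 1 / (a * b * c * d) * q ^ n / q"
    using assms by (simp add: power_int_diff)
  have m: "- (q ^ k / x) = - 1 / x * q ^ k" for k x by simp
  show ?thesis
    unfolding qinv_askey_wilson_explicit[OF assms] qinv_aw_scale_def qinv_aw_coeff_def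
      q_difference_coeff_def aw_basis_def qpochs_def list.map prod_list.Cons prod_list.Nil Y m mult_1_right
    by (simp only: times_divide_eq_right times_divide_eq_left mult_ac)
qed

lemma qinv_askey_wilson_connection:
  assumes "q \<noteq> 0" "a \<noteq> 0" "b \<noteq> 0" "c \<noteq> 0" "d \<noteq> 0"
  shows "\<exists>g. g n = qinv_aw_scale q a b c d n * qinv_aw_coeff q a b c d n n * (b / a) ^ n \<and>
    (\<forall>z. z \<noteq> 0 \<longrightarrow> qinv_askey_wilson n z a b c d q = (\<Sum>j\<le>n. g j * aw_basis q b j z))"
proof -
  have "\<forall>i. \<exists>g. g i = (b / a) ^ i \<and>
    (\<forall>z. z \<noteq> 0 \<longrightarrow> aw_basis q a i z = (\<Sum>j\<le>i. g j * aw_basis q b j z))"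
    using aw_basis_connection[OF assms(1-3)] by blast
  then obtain h where h: "\<And>i. h i i = (b / a) ^ i"
    "\<And>i z. z \<noteq> 0 \<Longrightarrow> aw_basis q a i z = (\<Sum>j\<le>i. h i j * aw_basis q b j z)"
    by metis
  \<comment> \<open>Extending by zero makes the range of summation independent of \<open>i\<close>, so the sums can be interchanged.\<close>
  define H where "H = (\<lambda>i j. if j \<le> i then h i j else 0)"
  have H: "aw_basis q a i z = (\<Sum>j\<le>n. H i j * aw_basis q b j z)" if "i \<le> n" "z \<noteq> 0" for i z
    unfolding h(2)[OF that(2)] using that(1) by (intro sum.mono_neutral_cong_left) (auto simp: H_def)
  define X where "X = (\<lambda>j. \<Sum>k\<le>n. qinv_aw_coeff q a b c d n k * H k j)"
  define g where "g = (\<lambda>j. qinv_aw_scale q a b c d n * X j)"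
  show ?thesis
  proof (intro exI[of _ g] conjI allI impI)
    have "(\<Sum>k\<le>n. qinv_aw_coeff q a b c d n k * H k n) = (\<Sum>k\<in>{n}. qinv_aw_coeff q a b c d n k * H k n)"
      by (rule sum.mono_neutral_right) (auto simp: H_def)
    then show "g n = qinv_aw_scale q a b c d n * qinv_aw_coeff q a b c d n n * (b / a) ^ n"
      by (simp add: g_def X_def H_def h(1))
  next
    fix z :: complex assume z: "z \<noteq> 0"
    have "(\<Sum>k\<le>n. qinv_aw_coeff q a b c d n k * aw_basis q a k z) =
        (\<Sum>k\<le>n. \<Sum>j\<le>n. qinv_aw_coeff q a b c d n k * H k j * aw_basis q b j z)"
      by (rule sum.cong) (simp_all add: H z sum_distrib_left mult.assoc)
    also have "\<dots> = (\<Sum>j\<le>n. X j * aw_basis q b j z)"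
      unfolding X_def sum_distrib_right by (rule sum.swap)
    finally show "qinv_askey_wilson n z a b c d q = (\<Sum>j\<le>n. g j * aw_basis q b j z)"
      unfolding qinv_askey_wilson_expand[OF assms z] by (simp add: g_def sum_distrib_left mult.assoc)
  qed
qed

text \<open>
  Summing the moments against the expansion of \<open>p\<^sub>n\<close>: the factors of the form \<open>(x;q)\<^sub>k (xq\<^sup>k;q)\<^sub>n\<^sub>-\<^sub>k\<close>
  combine to \<open>(x;q)\<^sub>n\<close> and can be taken out, so that the balanced series remains.
\<close>

lemma qinv_askey_wilson_moment:
  assumes q: "norm q < 1" "q \<noteq> 0" "\<alpha> \<noteq> 0" and nz: "a \<noteq> 0" "b \<noteq> 0" "c \<noteq> 0" "d \<noteq> 0"
    and conv: "norm (q * a * b * c * d / q ^ (n + j)) < 1"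
  shows "((\<lambda>k. aw_basis q b j (q powi k * \<alpha>) * qinv_askey_wilson n (q powi k * \<alpha>) a b c d q *
       weight q \<alpha> a b c d k) has_sum
     (weight_sum q \<alpha> a b c d * qinv_aw_scale q a b c d n *
       (qpoch (- 1 / (a * b)) q (int n) * qpoch (- 1 / (a * c)) q (int n) * qpoch (- 1 / (a * d)) q (int n) *
        (qpoch (- 1 / (b * c)) q (int j) * qpoch (- 1 / (b * d)) q (int j))) *
       (\<Sum>k\<le>n. q_difference_coeff q n k * (qpoch (- 1 / (a * b) * q ^ k) q (int j) *
          qpoch (1 / (a * b * c * d) * q ^ n / q) q (int k) / qpoch (1 / (a * b * c * d)) q (int (k + j))))))
     UNIV"
proof -
  let ?M = "\<lambda>i. weight_sum q \<alpha> a b c d *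
       (qpoch (- 1 / (a * b)) q (int (i + j)) *
        (qpoch (- 1 / (a * c)) q (int i) * qpoch (- 1 / (a * d)) q (int i)) *
        (qpoch (- 1 / (b * c)) q (int j) * qpoch (- 1 / (b * d)) q (int j)) /
        qpoch (1 / (a * b * c * d)) q (int (i + j)))"
  let ?e = "qinv_aw_coeff q a b c d n"
  let ?s = "qinv_aw_scale q a b c d n"
  have moment: "((\<lambda>k. aw_basis q a i (q powi k * \<alpha>) * aw_basis q b j (q powi k * \<alpha>) * weight q \<alpha> a b c d k)
      has_sum ?M i) UNIV" if "i \<le> n" for i
  proof (rule aw_basis_moment[OF q nz])
    have "q * a * b * c * d / q ^ (i + j) = q ^ (n - i) * (q * a * b * c * d / q ^ (n + j))"
      using that q by (simp add: power_diff power_add)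
    then show "norm (q * a * b * c * d / q ^ (i + j)) < 1"
      using norm_power_mult_less_1[OF q(1), of 0 "q * a * b * c * d / q ^ (n + j)" "n - i"] conv by simp
  qed
  have "((\<lambda>k. ?s * (\<Sum>i\<le>n. ?e i * (aw_basis q a i (q powi k * \<alpha>) * aw_basis q b j (q powi k * \<alpha>) * weight q \<alpha> a b c d k)))
      has_sum ?s * (\<Sum>i\<le>n. ?e i * ?M i)) UNIV"
    by (intro has_sum_cmult_right has_sum_finite_sum moment) auto
  also have "(\<lambda>k. ?s * (\<Sum>i\<le>n. ?e i * (aw_basis q a i (q powi k * \<alpha>) * aw_basis q b j (q powi k * \<alpha>) * weight q \<alpha> a b c d k)))
     = (\<lambda>k. aw_basis q b j (q powi k * \<alpha>) * qinv_askey_wilson n (q powi k * \<alpha>) a b c d q * weight q \<alpha> a b c d k)"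
  proof
    fix k
    have z: "q powi k * \<alpha> \<noteq> 0" using q by simp
    show "?s * (\<Sum>i\<le>n. ?e i * (aw_basis q a i (q powi k * \<alpha>) * aw_basis q b j (q powi k * \<alpha>) * weight q \<alpha> a b c d k))
      = aw_basis q b j (q powi k * \<alpha>) * qinv_askey_wilson n (q powi k * \<alpha>) a b c d q * weight q \<alpha> a b c d k"
      unfolding qinv_askey_wilson_expand[OF q(2) nz z] sum_distrib_left sum_distrib_right
      by (simp only: mult_ac)
  qed
  also have "(\<Sum>i\<le>n. ?e i * ?M i) =
     (\<Sum>k\<le>n. q_difference_coeff q n k * (qpoch (- 1 / (a * b) * q ^ k) q (int j) *
          qpoch (1 / (a * b * c * d) * q ^ n / q) q (int k) / qpoch (1 / (a * b * c * d)) q (int (k + j)))) *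
       (weight_sum q \<alpha> a b c d * (qpoch (- 1 / (a * b)) q (int n) * qpoch (- 1 / (a * c)) q (int n) * qpoch (- 1 / (a * d)) q (int n) *
        (qpoch (- 1 / (b * c)) q (int j) * qpoch (- 1 / (b * d)) q (int j))))"
    unfolding sum_distrib_right
  proof (rule sum.cong)
    fix k assume "k \<in> {..n}"
    then have "qpoch x q (int n) = qpoch x q (int k) * qpoch (x * q ^ k) q (int (n - k))" for x
      using qpoch_split[of x q k "n - k"] by simp
    note s = this[of "- 1 / (a * b)"] this[of "- 1 / (a * c)"] this[of "- 1 / (a * d)"]
      qpoch_split[of "- 1 / (a * b)" q k j]
    show "?e k * ?M k = q_difference_coeff q n k * (qpoch (- 1 / (a * b) * q ^ k) q (int j) *
          qpoch (1 / (a * b * c * d) * q ^ n / q) q (int k) / qpoch (1 / (a * b * c * d)) q (int (k + j))) *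
       (weight_sum q \<alpha> a b c d * (qpoch (- 1 / (a * b)) q (int n) * qpoch (- 1 / (a * c)) q (int n) * qpoch (- 1 / (a * d)) q (int n) *
        (qpoch (- 1 / (b * c)) q (int j) * qpoch (- 1 / (b * d)) q (int j))))"
      unfolding s qinv_aw_coeff_def divide_inverse[of _ "qpoch _ _ _"] by (simp only: mult_ac)
  qed simp
  finally show ?thesis by (simp only: mult_ac)
qed

text \<open>
  The hypothesis \<open>\<bar>qx\<bar> < \<bar>q\<bar>\<^sup>M\<close> with \<open>x = abcd\<close> makes \<open>q\<^sup>i/(qx)\<close> of norm greater than \<open>1\<close> for
  \<open>i \<le> M\<close>.  With \<open>M = 2 n\<close> this covers every factor that occurs in a denominator of the moments and of
  the norm.
\<close>

lemma conv_imp_nonzero_factors: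
  fixes q x :: complex
  assumes "norm q < 1" "q \<noteq> 0" "norm (q * x) < norm q ^ M" "i \<le> M" "x \<noteq> 0"
  shows "1 / x / q * q ^ i \<noteq> 1"
proof
  assume "1 / x / q * q ^ i = 1"
  then have "q * x = q ^ i" using assms by (simp add: field_simps)
  then have "norm q ^ i < norm q ^ M" using assms(3) by (simp add: norm_power)
  moreover have "norm q ^ M \<le> norm q ^ i"
    using assms by (intro power_decreasing) auto
  ultimately show False by simp
qed

lemma conv_imp_norm_less_1:
  fixes q x :: complex
  assumes "norm q < 1" "q \<noteq> 0" "norm x < norm q ^ M" "i \<le> M"
  shows "norm (x / q ^ i) < 1"
proof -
  have "norm x < norm q ^ i"
    using assms(3) power_decreasing[OF assms(4), of "norm q"] assms(1) by simp
  then show ?thesis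
    using assms(2) by (simp add: norm_divide norm_power)
qed

definition qinv_aw_norm :: "complex \<Rightarrow> complex \<Rightarrow> complex \<Rightarrow> complex \<Rightarrow> complex \<Rightarrow> nat \<Rightarrow> complex" where
  "qinv_aw_norm q a b c d n =
     q powi (- 6 * int (n choose 2)) * (- (a\<^sup>2 * b\<^sup>2 * c\<^sup>2 * d\<^sup>2)) ^ n
             * (qpochs [q, - 1 / (a * b), - 1 / (a * c), - 1 / (a * d),
                        - 1 / (b * c), - 1 / (b * d), - 1 / (c * d)] q (int n)
                * qpoch (1 / (q * a * b * c * d)) q (int (2 * n))
                / (qpoch (1 / (q * a * b * c * d)) q (int n)
                   * qpoch (1 / (a * b * c * d)) q (int (2 * n))))"

text \<open>
  The left-hand side is the leading coefficient of \<open>p\<^sub>n\<close> in the basis \<open>\<phi>\<^sub>j(z;b)\<close> times the pairing of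
  \<open>p\<^sub>n\<close> with \<open>\<phi>\<^sub>n(z;b)\<close>, both relative to the total mass.  The powers of \<open>q\<close> collect to
  \<open>q\<^sup>-\<^sup>6\<^sup>C\<close> with \<open>C = n choose 2\<close>: the scale enters twice with \<open>-3 C\<close>, the leading
  coefficient and the reversal of \<open>(-cdq\<^sup>1\<^sup>-\<^sup>n;q)\<^sub>n\<close> each give \<open>-C\<close>, and \<open>(q\<^sup>n\<^sup>-\<^sup>1)\<^sup>n\<close> gives \<open>2 C\<close>.
\<close>

lemma qinv_aw_norm_eq:
  assumes q: "norm q < 1" "q \<noteq> 0" and nz: "a \<noteq> 0" "b \<noteq> 0" "c \<noteq> 0" "d \<noteq> 0"
    and conv: "norm (q * a * b * c * d) < norm q ^ (2 * n)"
  shows "qinv_aw_scale q a b c d n * qinv_aw_coeff q a b c d n n * (b / a) ^ n *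
    (qinv_aw_scale q a b c d n *
       (qpoch (- 1 / (a * b)) q (int n) * qpoch (- 1 / (a * c)) q (int n) * qpoch (- 1 / (a * d)) q (int n) *
        (qpoch (- 1 / (b * c)) q (int n) * qpoch (- 1 / (b * d)) q (int n))) *
       (\<Sum>k\<le>n. q_difference_coeff q n k * (qpoch (- 1 / (a * b) * q ^ k) q (int n) *
          qpoch (1 / (a * b * c * d) * q ^ n / q) q (int k) / qpoch (1 / (a * b * c * d)) q (int (k + n)))))
    = qinv_aw_norm q a b c d n"
proof -
  define e where "e = a * b * c * d"
  define C where "C = q ^ (n choose 2)"
  have e: "e \<noteq> 0" and C: "C \<noteq> 0" using nz q by (simp_all add: e_def C_def)
  have qe': "q * a * b * c * d = q * e" by (simp only: e_def mult.assoc)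
  have v: "1 / e / q * q ^ i \<noteq> 1" if "i \<le> 2 * n" for i
    by (rule conv_imp_nonzero_factors[OF q conv[unfolded qe'] that e])
  have qe: "1 / (q * a * b * c * d) = 1 / e / q" unfolding qe' by simp
  have C2: "(q ^ n / q) ^ n = C\<^sup>2"
  proof -
    have "(q ^ n) ^ n = C\<^sup>2 * q ^ n"
      unfolding C_def power_mult[symmetric] power_add[symmetric]
      using two_mult_choose_two[of n] by (simp add: mult.commute)
    then show ?thesis using q by (simp add: power_divide)
  qed
  have arg: "- 1 / (a * b) / (1 / e * q ^ n / q) = q * (- (c * d) / q ^ n)"
    using q nz by (simp add: e_def field_simps)
  have S: "(\<Sum>k\<le>n. q_difference_coeff q n k * (qpoch (- 1 / (a * b) * q ^ k) q (int n) *
          qpoch (1 / e * q ^ n / q) q (int k) / qpoch (1 / e) q (int (k + n)))) =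
      qpoch (- 1 / (c * d)) q (int n) * ((c * d) ^ n / C) * (C\<^sup>2 / e ^ n) * qpoch q q (int n) / qpoch (1 / e) q (int (2 * n))"
  proof -
    have pw: "(1 / e * q ^ n / q) ^ n = C\<^sup>2 / e ^ n"
      unfolding C2[symmetric] power_divide power_mult_distrib by simp
    have "1 / - (c * d) = - 1 / (c * d)" by simp
    then have rev: "qpoch (q * (- (c * d) / q ^ n)) q (int n) = qpoch (- 1 / (c * d)) q (int n) * ((c * d) ^ n / C)"
      using qpoch_reverse[OF q(2), of "- (c * d)" n] nz unfolding C_def by (simp only: minus_minus) simp
    have "(\<Sum>k\<le>n. q_difference_coeff q n k * (qpoch (- 1 / (a * b) * q ^ k) q (int n) *
          qpoch (1 / e * q ^ n / q) q (int k) / qpoch (1 / e) q (int (k + n)))) =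
       qpoch (- 1 / (a * b) / (1 / e * q ^ n / q)) q (int n) * (1 / e * q ^ n / q) ^ n * qpoch q q (int n) /
         qpoch (1 / e) q (int (2 * n))"
      by (rule saalschuetz_sum[OF q _ v]) (use e in auto)
    then show ?thesis
      unfolding arg pw rev .
  qed
  have Y: "qpoch (1 / e * q ^ n / q) q (int n) = qpoch (1 / e / q) q (int (2 * n)) / qpoch (1 / e / q) q (int n)"
  proof -
    have "qpoch (1 / e / q) q (int n) \<noteq> 0"
      unfolding qpoch_nat prod_zero_iff[OF finite_lessThan] using v by auto
    moreover have "qpoch (1 / e / q) q (int (2 * n)) = qpoch (1 / e / q) q (int n) * qpoch (1 / e / q * q ^ n) q (int n)"
      unfolding mult_2 by (rule qpoch_split)
    moreover have "1 / e * q ^ n / q = 1 / e / q * q ^ n" by simp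
    ultimately show ?thesis by simp
  qed
  have s: "qinv_aw_scale q a b c d n * qinv_aw_scale q a b c d n =
     q powi (- 6 * int (n choose 2)) * (a ^ 4 * b\<^sup>2 * c\<^sup>2 * d\<^sup>2) ^ n"
  proof -
    have "- 6 * int (n choose 2) = - 3 * int (n choose 2) + - 3 * int (n choose 2)" by simp
    then have 1: "q powi (- 6 * int (n choose 2)) = q powi (- 3 * int (n choose 2)) * q powi (- 3 * int (n choose 2))"
      using q by (simp only: power_int_add simp_thms)
    have 2: "a ^ 4 * b\<^sup>2 * c\<^sup>2 * d\<^sup>2 = (- (a\<^sup>2 * b * c * d)) * (- (a\<^sup>2 * b * c * d))"
      by (simp add: power4_eq_xxxx power2_eq_square mult_ac)
    have 3: "(Q * X ^ n) * (Q * X ^ n) = (Q * Q) * (X * X) ^ n" for Q X :: complex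
      by (simp add: power_mult_distrib mult_ac)
    show ?thesis
      unfolding qinv_aw_scale_def 1 2 by (rule 3)
  qed
  have p: "(a ^ 4 * b\<^sup>2 * c\<^sup>2 * d\<^sup>2) ^ n * (- 1) ^ n * (b / a) ^ n * (c * d) ^ n / e ^ n = (- (a\<^sup>2 * b\<^sup>2 * c\<^sup>2 * d\<^sup>2)) ^ n"
    unfolding power_mult_distrib[symmetric] power_divide[symmetric]
    by (rule arg_cong[where f = "\<lambda>x. x ^ n"]) (use nz in \<open>simp add: e_def field_simps power4_eq_xxxx power2_eq_square\<close>)
  have alg: "(t * (k / C * Y * 1) * r) * (t * U * (w * (x / C) * (C\<^sup>2 / E) * y / z)) =
     (t * t) * (k * r * x / E) * (U * w * y * Y / z)" for t k Y r U w x E y z :: complex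
    using C by (simp add: power2_eq_square)
  have coeff: "qinv_aw_coeff q a b c d n n = (- 1) ^ n / C * qpoch (1 / e * q ^ n / q) q (int n) * 1"
    unfolding qinv_aw_coeff_def q_difference_coeff_self[OF q] e_def C_def by simp
  show ?thesis
    unfolding qinv_aw_norm_def p[symmetric] qe unfolding e_def[symmetric] coeff S alg s Y
    by (simp add: qpochs_def mult_ac)
qed

text \<open>
  Expanding \<open>p\<^sub>m\<close> in the basis \<open>\<phi>\<^sub>j(z;b)\<close>, \<open>j \<le> m \<le> n\<close>, every pairing with \<open>p\<^sub>n\<close> vanishes except the one
  with \<open>j = n\<close>, which is present only for \<open>m = n\<close>.
\<close>

lemma qinv_askey_wilson_orthogonality:
  assumes q: "norm q < 1" "q \<noteq> 0" "\<alpha> \<noteq> 0" and nz: "a \<noteq> 0" "b \<noteq> 0" "c \<noteq> 0" "d \<noteq> 0"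
    and conv: "norm (q * a * b * c * d) < norm q ^ (2 * n)" and "m \<le> n"
  shows "((\<lambda>k. qinv_askey_wilson m (q powi k * \<alpha>) a b c d q * qinv_askey_wilson n (q powi k * \<alpha>) a b c d q *
       weight q \<alpha> a b c d k) has_sum
     (weight_sum q \<alpha> a b c d * (if m = n then qinv_aw_norm q a b c d n else 0))) UNIV"
proof -
  define K where "K = (\<lambda>j. qinv_aw_scale q a b c d n *
       (qpoch (- 1 / (a * b)) q (int n) * qpoch (- 1 / (a * c)) q (int n) * qpoch (- 1 / (a * d)) q (int n) *
        (qpoch (- 1 / (b * c)) q (int j) * qpoch (- 1 / (b * d)) q (int j))))"
  define T where "T = (\<lambda>j. \<Sum>k\<le>n. q_difference_coeff q n k * (qpoch (- 1 / (a * b) * q ^ k) q (int j) *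
          qpoch (1 / (a * b * c * d) * q ^ n / q) q (int k) / qpoch (1 / (a * b * c * d)) q (int (k + j))))"
  obtain g where g: "g m = qinv_aw_scale q a b c d m * qinv_aw_coeff q a b c d m m * (b / a) ^ m"
    "\<And>z. z \<noteq> 0 \<Longrightarrow> qinv_askey_wilson m z a b c d q = (\<Sum>j\<le>m. g j * aw_basis q b j z)"
    using qinv_askey_wilson_connection[OF q(2) nz, of m] by blast
  have mom: "((\<lambda>k. aw_basis q b j (q powi k * \<alpha>) * qinv_askey_wilson n (q powi k * \<alpha>) a b c d q *
       weight q \<alpha> a b c d k) has_sum (weight_sum q \<alpha> a b c d * K j * T j)) UNIV" if "j \<le> m" for j
    unfolding K_def T_def mult.assoc[of "weight_sum q \<alpha> a b c d", symmetric]
    by (rule qinv_askey_wilson_moment[OF q nz conv_imp_norm_less_1[OF q(1,2) conv]])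
       (use that \<open>m \<le> n\<close> in simp)
  have "((\<lambda>k. \<Sum>j\<le>m. g j * (aw_basis q b j (q powi k * \<alpha>) * qinv_askey_wilson n (q powi k * \<alpha>) a b c d q *
       weight q \<alpha> a b c d k)) has_sum (\<Sum>j\<le>m. g j * (weight_sum q \<alpha> a b c d * K j * T j))) UNIV"
    by (intro has_sum_finite_sum has_sum_cmult_right mom) auto
  also have "(\<lambda>k. \<Sum>j\<le>m. g j * (aw_basis q b j (q powi k * \<alpha>) * qinv_askey_wilson n (q powi k * \<alpha>) a b c d q *
       weight q \<alpha> a b c d k)) = (\<lambda>k. qinv_askey_wilson m (q powi k * \<alpha>) a b c d q *
       qinv_askey_wilson n (q powi k * \<alpha>) a b c d q * weight q \<alpha> a b c d k)"
    using q by (simp add: g(2) sum_distrib_right mult.assoc)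
  also have "(\<Sum>j\<le>m. g j * (weight_sum q \<alpha> a b c d * K j * T j)) =
     weight_sum q \<alpha> a b c d * (if m = n then qinv_aw_norm q a b c d n else 0)"
  proof -
    have e: "q * a * b * c * d = q * (a * b * c * d)" "a * b * c * d \<noteq> 0"
      using nz by (simp_all add: mult.assoc)
    have v: "1 / (a * b * c * d) * q ^ i \<noteq> 1" if "i < 2 * n" for i
      using conv_imp_nonzero_factors[OF q(1,2) conv[unfolded e(1)] _ e(2), of "Suc i"] that q by simp
    have T0: "T j = 0" if "j < n" for j
      unfolding T_def by (rule saalschuetz_sum_eq_0[OF q(1,2) v that])
    show ?thesis
    proof (cases "m = n")
      case True
      have "(\<Sum>j\<le>m. g j * (weight_sum q \<alpha> a b c d * K j * T j)) =
         (\<Sum>j\<in>{n}. g j * (weight_sum q \<alpha> a b c d * K j * T j))"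
        using True T0 by (intro sum.mono_neutral_right) auto
      also have "\<dots> = weight_sum q \<alpha> a b c d * (g n * (K n * T n))" by simp
      also have "g n * (K n * T n) = qinv_aw_norm q a b c d n"
        using g(1) True qinv_aw_norm_eq[OF q(1,2) nz conv] by (simp add: K_def T_def)
      finally show ?thesis using True by simp
    next
      case False
      then show ?thesis using T0 \<open>m \<le> n\<close> by simp
    qed
  qed
  finally show ?thesis .
qed

section \<open>Return to shifted factorials of the summand\<close>

lemma qpoch_divide_qpoch_inf:
  assumes "norm q < 1" "q \<noteq> 0" "qpoch_inf y q \<noteq> 0"
  shows "1 / qpoch y q k = qpoch_inf (y * q powi k) q / qpoch_inf y q"
proof (cases "k \<ge> 0")
  case True
  then obtain n where k: "k = int n" by (metis nonneg_int_cases)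
  show ?thesis
    using qpoch_inf_split[OF assms(1), of y n] assms(3) unfolding k power_int_of_nat by auto
next
  case False
  then obtain n where k: "k = - int n" by (metis int_cases2 of_nat_0_le_iff)
  have e: "y * q powi - int n * q ^ n = y"
    using assms(2) by (simp add: power_int_minus)
  show ?thesis
    unfolding k inverse_qpoch_neg
    using qpoch_inf_split[OF assms(1), of "y * q powi - int n" n, unfolded e] assms(3) by simp
qed

text \<open>
  Reversing \<open>(y;q)\<^sub>k\<close> trades it for a shifted factorial of \<open>q/y\<close> with index \<open>-k\<close>.  For
  \<open>y = \<alpha>/t\<close> the reciprocal of the latter is a quotient of infinite products as soon as
  \<open>(qt/\<alpha>;q)\<^sub>\<infinity> \<noteq> 0\<close>, even when \<open>(y;q)\<^sub>\<infinity> = 0\<close>.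
\<close>

lemma qpoch_reflect:
  assumes "q \<noteq> 0" "y \<noteq> 0"
  shows "qpoch y q k = (- y) powi k * q powi (k * (k - 1) div 2) * (1 / qpoch (q / y) q (- k))"
proof (cases "k \<ge> 0")
  case True
  then obtain n where k: "k = int n" by (metis nonneg_int_cases)
  have "int n * int n = 2 * int (n choose 2) + int n"
    using arg_cong[OF two_mult_choose_two[of n], of int] by simp
  then have "k * (k - 1) = 2 * int (n choose 2)"
    unfolding k by (simp add: algebra_simps)
  then have ch: "k * (k - 1) div 2 = int (n choose 2)" by simp
  have arg: "q / y * q powi - int n = q * ((1 / y) / q ^ n)"
    by (simp add: power_int_minus divide_inverse mult_ac)
  have "(- y) ^ n * (- (1 / y)) ^ n = 1"
    unfolding power_mult_distrib[symmetric] using assms(2) by simp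
  moreover have "qpoch (q * ((1 / y) / q ^ n)) q (int n) = qpoch y q (int n) * ((- (1 / y)) ^ n / q ^ (n choose 2))"
    using qpoch_reverse[OF assms(1), of "1 / y" n] assms(2) by simp
  ultimately show ?thesis
    unfolding ch unfolding k inverse_qpoch_neg arg power_int_of_nat
    using assms(1) by (simp add: mult_ac)
next
  case False
  then obtain n where k: "k = - int n" by (metis int_cases2 of_nat_0_le_iff)
  have "int n * int n = 2 * int (n choose 2) + int n"
    using arg_cong[OF two_mult_choose_two[of n], of int] by simp
  then have "k * (k - 1) = 2 * int ((n choose 2) + n)"
    unfolding k by (simp add: algebra_simps)
  then have ch: "k * (k - 1) div 2 = int ((n choose 2) + n)" by simp
  have arg: "y * q powi - int n = q * ((y / q) / q ^ n)"
    using assms by (simp add: power_int_minus divide_inverse mult_ac)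
  have y: "y / q \<noteq> 0" using assms by simp
  have "1 / qpoch y q (- int n) = qpoch (1 / (y / q)) q (int n) * ((- (y / q)) ^ n / q ^ (n choose 2))"
    unfolding inverse_qpoch_neg arg by (rule qpoch_reverse[OF assms(1) y])
  then have "qpoch y q (- int n) = 1 / (qpoch (q / y) q (int n) * ((- (y / q)) ^ n / q ^ (n choose 2)))"
    by (metis div_by_1 divide_divide_eq_right mult_1)
  also have "(- (y / q)) ^ n = (- y) ^ n / q ^ n"
    unfolding power_divide[symmetric] by simp
  finally show ?thesis
    unfolding ch power_int_of_nat unfolding k power_int_minus power_int_of_nat
    using assms by (simp add: power_add divide_inverse mult_ac)
qed

lemma qpoch_quotient_eq_pair_factor:
  assumes q: "norm q < 1" "q \<noteq> 0" "\<alpha> \<noteq> 0" "t \<noteq> 0"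
    and "qpoch_inf (- q * \<alpha> * t) q \<noteq> 0" "qpoch_inf (q * t / \<alpha>) q \<noteq> 0"
  shows "qpoch (\<alpha> / t) q k / qpoch (- q * \<alpha> * t) q k =
    (- \<alpha> / t) powi k * q powi (k * (k - 1) div 2) *
      (pair_factor q (q powi k * \<alpha>) t / pair_factor q \<alpha> t)"
proof -
  have 1: "1 / qpoch (- q * \<alpha> * t) q k = qpoch_inf (- q * (q powi k * \<alpha>) * t) q / qpoch_inf (- q * \<alpha> * t) q"
    unfolding qpoch_divide_qpoch_inf[OF q(1,2) assms(5)] by (simp only: mult_ac)
  have 2: "1 / qpoch (q / (\<alpha> / t)) q (- k) = qpoch_inf (q * t / (q powi k * \<alpha>)) q / qpoch_inf (q * t / \<alpha>) q"
  proof -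
    have "q / (\<alpha> / t) = q * t / \<alpha>" "q * t / \<alpha> * q powi (- k) = q * t / (q powi k * \<alpha>)"
      by (simp_all add: power_int_minus divide_inverse mult_ac)
    then show ?thesis using qpoch_divide_qpoch_inf[OF q(1,2) assms(6), of "- k"] by simp
  qed
  have "\<alpha> / t \<noteq> 0" using q by simp
  from qpoch_reflect[OF q(2) this, of k] have "qpoch (\<alpha> / t) q k * (1 / qpoch (- q * \<alpha> * t) q k) =
    (- (\<alpha> / t)) powi k * q powi (k * (k - 1) div 2) *
      (qpoch_inf (q * t / (q powi k * \<alpha>)) q / qpoch_inf (q * t / \<alpha>) q) *
      (qpoch_inf (- q * (q powi k * \<alpha>) * t) q / qpoch_inf (- q * \<alpha> * t) q)"
    unfolding 1 2 by simp
  then show ?thesis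
    unfolding pair_factor_def by (simp add: mult_ac)
qed

text \<open>
  The four powers of \<open>q\<close> with exponent \<open>k(k - 1)/2\<close> and the power of \<open>qabcd\<close> make up the Gaussian factor of
  the weight; in it \<open>a, b, c, d\<close> cancel.
\<close>

lemma bilateral_summand_eq_weight:
  assumes q: "norm q < 1" "q \<noteq> 0" "\<alpha> \<noteq> 0" and nz: "a \<noteq> 0" "b \<noteq> 0" "c \<noteq> 0" "d \<noteq> 0"
    and "\<And>t. t \<in> {a, b, c, d} \<Longrightarrow> qpoch_inf (- q * \<alpha> * t) q \<noteq> 0"
    and "\<And>t. t \<in> {a, b, c, d} \<Longrightarrow> qpoch_inf (q * t / \<alpha>) q \<noteq> 0"
  shows "(1 + q powi (2 * k) * \<alpha>\<^sup>2) *
     (qpochs [\<alpha> / a, \<alpha> / b, \<alpha> / c, \<alpha> / d] q k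
               / qpochs [- q * \<alpha> * a, - q * \<alpha> * b, - q * \<alpha> * c, - q * \<alpha> * d] q k)
            * (q * a * b * c * d) powi k =
     weight q \<alpha> a b c d k /
       (pair_factor q \<alpha> a * pair_factor q \<alpha> b * pair_factor q \<alpha> c * pair_factor q \<alpha> d)"
proof -
  define h where "h = k * (k - 1) div 2"
  note quot = qpoch_quotient_eq_pair_factor[OF q _ assms(8,9), where k = k, folded h_def]
  have h2: "2 * h = k * (k - 1)" unfolding h_def by simp
  have "(q powi h) ^ 4 * (((- \<alpha> / a) * (- \<alpha> / b) * (- \<alpha> / c) * (- \<alpha> / d)) * (q * a * b * c * d)) powi k
     = \<alpha> powi (4 * k) * q powi (2 * k\<^sup>2 - k)"
  proof -
    have "(- \<alpha> / a) * (- \<alpha> / b) * (- \<alpha> / c) * (- \<alpha> / d) * (q * a * b * c * d) = \<alpha> ^ 4 * q"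
      using nz by (simp add: power4_eq_xxxx)
    moreover have "(\<alpha> ^ 4 * q) powi k = \<alpha> powi (4 * k) * q powi k"
      by (simp add: power_int_mult_distrib power_int_mult)
    moreover have "2 * k\<^sup>2 - k = h * 4 + k"
      using h2 by (simp add: power2_eq_square algebra_simps)
    moreover have "q powi (h * 4 + k) = (q powi h) ^ 4 * q powi k"
      using q by (simp only: power_int_add power_int_mult simp_thms power_int_numeral)
    ultimately show ?thesis by (simp only: mult_ac)
  qed
  note scal = this
  have "qpochs [\<alpha> / a, \<alpha> / b, \<alpha> / c, \<alpha> / d] q k
          / qpochs [- q * \<alpha> * a, - q * \<alpha> * b, - q * \<alpha> * c, - q * \<alpha> * d] q k =
     (qpoch (\<alpha> / a) q k / qpoch (- q * \<alpha> * a) q k) * (qpoch (\<alpha> / b) q k / qpoch (- q * \<alpha> * b) q k) *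
     (qpoch (\<alpha> / c) q k / qpoch (- q * \<alpha> * c) q k) * (qpoch (\<alpha> / d) q k / qpoch (- q * \<alpha> * d) q k)"
    by (simp add: qpochs_def mult_ac)
  also have "\<dots> = (q powi h) ^ 4 * ((- \<alpha> / a) * (- \<alpha> / b) * (- \<alpha> / c) * (- \<alpha> / d)) powi k *
      ((pair_factor q (q powi k * \<alpha>) a * pair_factor q (q powi k * \<alpha>) b *
        pair_factor q (q powi k * \<alpha>) c * pair_factor q (q powi k * \<alpha>) d) /
       (pair_factor q \<alpha> a * pair_factor q \<alpha> b * pair_factor q \<alpha> c * pair_factor q \<alpha> d))"
  proof -
    have alg: "(A1 * H * (P1 / Q1)) * (A2 * H * (P2 / Q2)) * (A3 * H * (P3 / Q3)) * (A4 * H * (P4 / Q4)) =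
      H ^ 4 * (A1 * A2 * A3 * A4) * ((P1 * P2 * P3 * P4) / (Q1 * Q2 * Q3 * Q4))"
      for A1 A2 A3 A4 H P1 P2 P3 P4 Q1 Q2 Q3 Q4 :: complex
      by (simp add: power4_eq_xxxx mult_ac)
    have mem: "a \<in> {a, b, c, d}" "b \<in> {a, b, c, d}" "c \<in> {a, b, c, d}" "d \<in> {a, b, c, d}"
      by simp_all
    show ?thesis
      unfolding quot[OF nz(1) mem(1) mem(1)] quot[OF nz(2) mem(2) mem(2)]
        quot[OF nz(3) mem(3) mem(3)] quot[OF nz(4) mem(4) mem(4)] power_int_mult_distrib by (rule alg)
  qed
  finally have quotients: "qpochs [\<alpha> / a, \<alpha> / b, \<alpha> / c, \<alpha> / d] q k
          / qpochs [- q * \<alpha> * a, - q * \<alpha> * b, - q * \<alpha> * c, - q * \<alpha> * d] q k = \<dots>" .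
  have z: "1 + q powi (2 * k) * \<alpha>\<^sup>2 = 1 + (q powi k * \<alpha>)\<^sup>2"
    by (simp add: power_mult_distrib power_int_mult mult.commute[of 2])
  show ?thesis
    unfolding quotients z weight_def scal[symmetric] unfolding power_int_mult_distrib
    by (simp add: mult_ac)
qed

theorem theorem3p1:
  fixes m n N :: nat and q \<alpha> a b c d :: complex
  assumes "0 < norm q" and "norm q < 1"
    and "\<alpha> \<noteq> 0" and "a \<noteq> 0" and "b \<noteq> 0" and "c \<noteq> 0" and "d \<noteq> 0"
    and "\<And>t. t \<in> {a, b, c, d} \<Longrightarrow> qpoch_inf (- q * \<alpha> * t) q \<noteq> 0"
    and "\<And>t. t \<in> {a, b, c, d} \<Longrightarrow> qpoch_inf (q * t / \<alpha>) q \<noteq> 0"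
    and "n \<le> N" and "m \<le> N"
    and "norm (q * a * b * c * d) < norm q ^ (2 * N)"
  shows "((\<lambda>k :: int.
            (1 + q powi (2 * k) * \<alpha>\<^sup>2)
            * qinv_askey_wilson m (q powi k * \<alpha>) a b c d q
            * qinv_askey_wilson n (q powi k * \<alpha>) a b c d q
            * (qpochs [\<alpha> / a, \<alpha> / b, \<alpha> / c, \<alpha> / d] q k
               / qpochs [- q * \<alpha> * a, - q * \<alpha> * b, - q * \<alpha> * c, - q * \<alpha> * d] q k)
            * (q * a * b * c * d) powi k)
          has_sum
            (qpochs_inf [q, - (\<alpha>\<^sup>2), - q / \<alpha>\<^sup>2, - q * a * b, - q * a * c, - q * a * d,
                         - q * b * c, - q * b * d, - q * c * d] q
             / qpochs_inf [- q * \<alpha> * a, - q * \<alpha> * b, - q * \<alpha> * c, - q * \<alpha> * d,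
                           q * a / \<alpha>, q * b / \<alpha>, q * c / \<alpha>, q * d / \<alpha>, q * a * b * c * d] q
             * q powi (- 6 * int (n choose 2)) * (- (a\<^sup>2 * b\<^sup>2 * c\<^sup>2 * d\<^sup>2)) ^ n
             * (qpochs [q, - 1 / (a * b), - 1 / (a * c), - 1 / (a * d),
                        - 1 / (b * c), - 1 / (b * d), - 1 / (c * d)] q (int n)
                * qpoch (1 / (q * a * b * c * d)) q (int (2 * n))
                / (qpoch (1 / (q * a * b * c * d)) q (int n)
                   * qpoch (1 / (a * b * c * d)) q (int (2 * n))))
             * (if m = n then 1 else 0)))
         UNIV"
proof -
  have q: "norm q < 1" "q \<noteq> 0" "\<alpha> \<noteq> 0" using assms by auto
  note nz = assms(4-7)
  define E where "E = pair_factor q \<alpha> a * pair_factor q \<alpha> b * pair_factor q \<alpha> c * pair_factor q \<alpha> d"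
  define P where "P = (\<lambda>n k. qinv_askey_wilson n (q powi k * \<alpha>) a b c d q)"
  have conv: "norm (q * a * b * c * d) < norm q ^ (2 * i)" if "i \<le> N" for i
    by (rule order.strict_trans2[OF assms(12) power_decreasing]) (use that q in auto)
  have conv0: "norm (q * a * b * c * d) < 1" using conv[of 0] by simp
  have "((\<lambda>k. P m k * P n k * weight q \<alpha> a b c d k) has_sum
      weight_sum q \<alpha> a b c d * (if m = n then qinv_aw_norm q a b c d n else 0)) UNIV"
  proof (cases "m \<le> n")
    case True
    then show ?thesis
      unfolding P_def by (rule qinv_askey_wilson_orthogonality[OF q nz conv[OF assms(10)]])
  next
    case False
    then have "n \<le> m" by simp
    from qinv_askey_wilson_orthogonality[OF q nz conv[OF assms(11)] this] show ?thesis
      using False unfolding P_def by (simp add: mult_ac)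
  qed
  from has_sum_cmult_right[OF this, of "1 / E"]
  have total: "((\<lambda>k. P m k * P n k * (weight q \<alpha> a b c d k / E)) has_sum
      weight_sum q \<alpha> a b c d / E * (if m = n then qinv_aw_norm q a b c d n else 0)) UNIV"
    by simp
  have alg: "A * B * (X * Y * Z) = X * A * B * Y * Z" for A B X Y Z :: complex
    by (simp only: mult_ac)
  have summand: "(\<lambda>k. P m k * P n k * (weight q \<alpha> a b c d k / E)) =
     (\<lambda>k. (1 + q powi (2 * k) * \<alpha>\<^sup>2) * P m k * P n k
            * (qpochs [\<alpha> / a, \<alpha> / b, \<alpha> / c, \<alpha> / d] q k
               / qpochs [- q * \<alpha> * a, - q * \<alpha> * b, - q * \<alpha> * c, - q * \<alpha> * d] q k)
            * (q * a * b * c * d) powi k)"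
  proof
    fix k
    have "weight q \<alpha> a b c d k / E = (1 + q powi (2 * k) * \<alpha>\<^sup>2) *
       (qpochs [\<alpha> / a, \<alpha> / b, \<alpha> / c, \<alpha> / d] q k
               / qpochs [- q * \<alpha> * a, - q * \<alpha> * b, - q * \<alpha> * c, - q * \<alpha> * d] q k)
            * (q * a * b * c * d) powi k"
      unfolding E_def by (rule bilateral_summand_eq_weight[OF q nz assms(8,9), symmetric])
    then show "P m k * P n k * (weight q \<alpha> a b c d k / E) =
        (1 + q powi (2 * k) * \<alpha>\<^sup>2) * P m k * P n k
            * (qpochs [\<alpha> / a, \<alpha> / b, \<alpha> / c, \<alpha> / d] q k
               / qpochs [- q * \<alpha> * a, - q * \<alpha> * b, - q * \<alpha> * c, - q * \<alpha> * d] q k)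
            * (q * a * b * c * d) powi k"
      by (simp only: alg)
  qed
  have prefactor: "weight_sum q \<alpha> a b c d / E =
     qpochs_inf [q, - (\<alpha>\<^sup>2), - q / \<alpha>\<^sup>2, - q * a * b, - q * a * c, - q * a * d,
                         - q * b * c, - q * b * d, - q * c * d] q
             / qpochs_inf [- q * \<alpha> * a, - q * \<alpha> * b, - q * \<alpha> * c, - q * \<alpha> * d,
                           q * a / \<alpha>, q * b / \<alpha>, q * c / \<alpha>, q * d / \<alpha>, q * a * b * c * d] q"
    (is "_ = ?Q")
    unfolding bailey_6psi6[OF q conv0] E_def pair_factor_def qpochs_inf_def list.map prod_list.Cons prod_list.Nil
    by (simp only: divide_divide_eq_left mult_1_right mult_1_left mult_ac)
  have norm: "?Q * (if m = n then qinv_aw_norm q a b c d n else 0) = ?Q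
             * q powi (- 6 * int (n choose 2)) * (- (a\<^sup>2 * b\<^sup>2 * c\<^sup>2 * d\<^sup>2)) ^ n
             * (qpochs [q, - 1 / (a * b), - 1 / (a * c), - 1 / (a * d),
                        - 1 / (b * c), - 1 / (b * d), - 1 / (c * d)] q (int n)
                * qpoch (1 / (q * a * b * c * d)) q (int (2 * n))
                / (qpoch (1 / (q * a * b * c * d)) q (int n)
                   * qpoch (1 / (a * b * c * d)) q (int (2 * n))))
             * (if m = n then 1 else 0)"
    unfolding qinv_aw_norm_def by (cases "m = n") (simp_all only: if_True if_False simp_thms mult_1_right mult_zero_right mult.assoc)
  show ?thesis
    using total unfolding summand prefactor norm unfolding P_def .
qed

end
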